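(* Let $n\ge1$ and $\mu=(\mu_1,\ldots,\mu_n)\in[-1/2,\infty)^n$. Let $T\in\mathcal{H}'_\mu$ satisfy $(T,\phi)=0$ for every $\phi\in\mathcal{H}_\mu$ for which $\operatorname{supp}(\phi)\subset\{x\in(0,\infty)^n:\|x\|\ge a\}$ for some $a\in\mathbb{R}$, $a>0$. Then there exist $N\in\mathbb{N}_0$ and scalars $c_k$, $|k|\le N$, such that $$T=\sum_{|k|\le N}c_k\,S^k\delta_\mu .$$
   Context: Multi-indices are elements $k=(k_1,\ldots,k_n)\in\mathbb{N}_0^n$, with $|k|=k_1+\cdots+k_n$; $\|x\|=(x_1^2+\cdots+x_n^2)^{1/2}$; $x^{m}=x_1^{m_1}\cdots x_n^{m_n}$; $-\mu-1/2=(-\mu_1-1/2,\ldots,-\mu_n-1/2)$. Let $T_i=x_i^{-1}\frac{\partial}{\partial x_i}$ and $T^k=T_n^{k_n}\circ\cdots\circ T_1^{k_1}$. The space $\mathcal{H}_\mu$ consists of all (complex-valued) $\phi\in C^\infty((0,\infty)^n)$ such that for all $m\in\mathbb{N}_0$, $k\in\mathbb{N}_0^n$, $$\gamma^\mu_{m,k}(\phi)=\sup_{x\in(0,\infty)^n}\left|(1+\|x\|^2)^m\,T^k\{x^{-\mu-1/2}\phi(x)\}\right|<\infty,$$ and it is a Fréchet space with the topology generated by the seminorms $\gamma^\mu_{m,k}$. $\mathcal{H}'_\mu$ is its dual (continuous linear functionals), with pairing $(f,\phi)$. For $i=1,\ldots,n$ let $S_{\mu_i}=\frac{\partial^2}{\partial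 x_i^2}-\frac{4\mu_i^2-1}{4x_i^2}$ and, for a multi-index $k$, $S^k=S_{\mu_1}^{k_1}\circ\cdots\circ S_{\mu_n}^{k_n}$. These operators map $\mathcal{H}_\mu$ continuously into itself, and are extended to $\mathcal{H}'_\mu$ by $(S^kf,\phi)=(f,S^k\phi)$ for $f\in\mathcal{H}'_\mu$, $\phi\in\mathcal{H}_\mu$. The functional $\delta_\mu\in\mathcal{H}'_\mu$ is defined by $(\delta_\mu,\phi)=C_\mu\lim_{x\to0,\;x_i>0}x^{-\mu-1/2}\phi(x)$, where $C_\mu=\prod_{i=1}^n2^{\mu_i}\Gamma(\mu_i+1)$ (the limit exists for every $\phi\in\mathcal{H}_\mu$). *)

theory Defs
  imports "HOL-Analysis.Analysis"
begin

text \<open>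
  Coordinates are indexed by a finite linearly ordered type \<open>'n\<close>, which plays the role of
  \<open>{1,...,n}\<close>; the order fixes the order of composition in the operators of multi-index
  order. A multi-index is a function \<open>'n \<Rightarrow> nat\<close>.
\<close>

type_synonym 'n multi_index = "'n \<Rightarrow> nat"

definition mi_abs :: "'n::finite multi_index \<Rightarrow> nat" where
  "mi_abs k = (\<Sum>i\<in>UNIV. k i)"

lemma finite_mi_abs_le: "finite {k :: 'n::finite multi_index. mi_abs k \<le> N}"
proof (rule finite_subset)
  show "{k :: 'n multi_index. mi_abs k \<le> N} \<subseteq> UNIV \<rightarrow>\<^sub>E {..N}"
  proof
    fix k :: "'n multi_index"
    assume "k \<in> {k. mi_abs k \<le> N}"
    moreover have "k i \<le> mi_abs k" for i
      unfolding mi_abs_def by (rule member_le_sum) auto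
    ultimately show "k \<in> UNIV \<rightarrow>\<^sub>E {..N}"
      by (auto intro: order_trans)
  qed
  show "finite (UNIV \<rightarrow>\<^sub>E {..N} :: 'n multi_index set)"
    by (rule finite_PiE) auto
qed

definition orthant :: "(real ^ 'n) set" where
  "orthant = {x. \<forall>i. 0 < x $ i}"

definition partial_deriv :: "'n::finite \<Rightarrow> (real ^ 'n \<Rightarrow> complex) \<Rightarrow> real ^ 'n \<Rightarrow> complex" where
  "partial_deriv i f x = vector_derivative (\<lambda>t. f (x + t *\<^sub>R axis i 1)) (at 0)"

primrec C_k_on :: "nat \<Rightarrow> (real ^ 'n::finite) set \<Rightarrow> (real ^ 'n \<Rightarrow> complex) \<Rightarrow> bool" where
  "C_k_on 0 U f \<longleftrightarrow> continuous_on U f"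
| "C_k_on (Suc m) U f \<longleftrightarrow> continuous_on U f \<and>
     (\<forall>i. (\<forall>x\<in>U. (\<lambda>t. f (x + t *\<^sub>R axis i 1)) differentiable at 0) \<and>
          C_k_on m U (partial_deriv i f))"

definition C_infinity_on :: "(real ^ 'n::finite) set \<Rightarrow> (real ^ 'n \<Rightarrow> complex) \<Rightarrow> bool" where
  "C_infinity_on U f \<longleftrightarrow> (\<forall>m. C_k_on m U f)"

definition vec_powr :: "real ^ 'n::finite \<Rightarrow> real ^ 'n \<Rightarrow> real" where
  "vec_powr x a = (\<Prod>i\<in>UNIV. (x $ i) powr (a $ i))"

definition weighted :: "real ^ 'n::finite \<Rightarrow> (real ^ 'n \<Rightarrow> complex) \<Rightarrow> real ^ 'n \<Rightarrow> complex" where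
  "weighted \<mu> \<phi> x = vec_powr x (\<chi> i. - \<mu> $ i - 1/2) *\<^sub>R \<phi> x"

definition T_op :: "'n::finite \<Rightarrow> (real ^ 'n \<Rightarrow> complex) \<Rightarrow> real ^ 'n \<Rightarrow> complex" where
  "T_op i f x = inverse (x $ i) *\<^sub>R partial_deriv i f x"

text \<open>\<open>T\<^sup>k = T\<^sub>n\<^sup>k\<^sup>n \<circ> \<dots> \<circ> T\<^sub>1\<^sup>k\<^sup>1\<close>: \<open>fold\<close> applies the operator of the least index first.\<close>

definition T_pow ::
  "'n::{finite,linorder} multi_index \<Rightarrow> ((real, 'n) vec \<Rightarrow> complex) \<Rightarrow> (real, 'n) vec \<Rightarrow> complex" where
  "T_pow k f = fold (\<lambda>i. T_op i ^^ k i) (sorted_list_of_set UNIV) f"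

definition Hmu_seminorm ::
  "(real, 'n) vec \<Rightarrow> nat \<Rightarrow> 'n::{finite,linorder} multi_index \<Rightarrow> ((real, 'n) vec \<Rightarrow> complex) \<Rightarrow> ennreal" where
  "Hmu_seminorm \<mu> m k \<phi> =
     (SUP x\<in>orthant. ennreal (norm ((1 + (norm x)\<^sup>2) ^ m *\<^sub>R T_pow k (weighted \<mu> \<phi>) x)))"

text \<open>
  A function on the open orthant is represented by its extension by zero to the whole space,
  so that equality in \<open>Hmu\<close> is equality of functions. No regularity is required across the
  boundary of the orthant.
\<close>

definition Hmu :: "(real, 'n::{finite,linorder}) vec \<Rightarrow> ((real, 'n) vec \<Rightarrow> complex) set" where
  "Hmu \<mu> = {\<phi>. (\<forall>x. x \<notin> orthant \<longrightarrow> \<phi> x = 0) \<and> C_infinity_on orthant \<phi> \<and>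
               (\<forall>m k. Hmu_seminorm \<mu> m k \<phi> < \<infinity>)}"

definition Hmu_topology ::
  "(real, 'n::{finite,linorder}) vec \<Rightarrow> ((real, 'n) vec \<Rightarrow> complex) topology" where
  "Hmu_topology \<mu> = topology_generated_by
     {{\<psi> \<in> Hmu \<mu>. Hmu_seminorm \<mu> m k (\<lambda>x. \<psi> x - \<phi> x) < ennreal r} | m k \<phi> r.
        \<phi> \<in> Hmu \<mu> \<and> 0 < r}"

lemma Hmu_seminorm_zero: "Hmu_seminorm \<mu> m k (\<lambda>x. 0) = 0"
proof -
  have T: "T_op i (\<lambda>x. 0) = (\<lambda>x. 0)" for i :: 'a
    by (rule ext) (simp add: T_op_def partial_deriv_def)
  have Tn: "(T_op i ^^ j) (\<lambda>x. 0) = (\<lambda>x. 0)" for i :: 'a and j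
    by (induction j) (simp_all add: T)
  have "fold (\<lambda>i. T_op i ^^ k i) xs (\<lambda>x. 0) = (\<lambda>x. 0)" for xs :: "'a list"
    by (induction xs) (simp_all add: Tn)
  moreover have "weighted \<mu> (\<lambda>x. 0) = (\<lambda>x. 0)"
    by (rule ext) (simp add: weighted_def)
  ultimately have "T_pow k (weighted \<mu> (\<lambda>x. 0)) = (\<lambda>x. 0)"
    by (simp add: T_pow_def)
  then show ?thesis
    by (simp add: Hmu_seminorm_def flip: bot_ennreal)
qed

lemma topspace_Hmu_topology: "topspace (Hmu_topology \<mu>) = Hmu \<mu>"
proof
  show "topspace (Hmu_topology \<mu>) \<subseteq> Hmu \<mu>"
    unfolding Hmu_topology_def topology_generated_by_topspace by blast
  show "Hmu \<mu> \<subseteq> topspace (Hmu_topology \<mu>)"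
  proof
    fix \<phi> assume "\<phi> \<in> Hmu \<mu>"
    then have "\<phi> \<in> {\<psi> \<in> Hmu \<mu>. Hmu_seminorm \<mu> 0 (\<lambda>_. 0) (\<lambda>x. \<psi> x - \<phi> x) < ennreal 1}"
      by (simp add: Hmu_seminorm_zero)
    with \<open>\<phi> \<in> Hmu \<mu>\<close> show "\<phi> \<in> topspace (Hmu_topology \<mu>)"
      unfolding Hmu_topology_def topology_generated_by_topspace
      by (blast intro: zero_less_one)
  qed
qed

text \<open>
  Functionals are total on the function type; only their values on \<open>Hmu \<mu>\<close> are meaningful.
\<close>

definition Hmu_dual ::
  "(real, 'n::{finite,linorder}) vec \<Rightarrow> (((real, 'n) vec \<Rightarrow> complex) \<Rightarrow> complex) set" where
  "Hmu_dual \<mu> = {f.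
     (\<forall>\<phi>\<in>Hmu \<mu>. \<forall>\<psi>\<in>Hmu \<mu>. f (\<lambda>x. \<phi> x + \<psi> x) = f \<phi> + f \<psi>) \<and>
     (\<forall>c. \<forall>\<phi>\<in>Hmu \<mu>. f (\<lambda>x. c * \<phi> x) = c * f \<phi>) \<and>
     continuous_map (Hmu_topology \<mu>) euclidean f}"

text \<open>The case distinction keeps the extension by zero.\<close>

definition S_op ::
  "real ^ 'n \<Rightarrow> 'n::finite \<Rightarrow> (real ^ 'n \<Rightarrow> complex) \<Rightarrow> real ^ 'n \<Rightarrow> complex" where
  "S_op \<mu> i \<phi> x =
     (if x \<in> orthant
      then partial_deriv i (partial_deriv i \<phi>) x
           - ((4 * (\<mu> $ i)\<^sup>2 - 1) / (4 * (x $ i)\<^sup>2)) *\<^sub>R \<phi> x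
      else 0)"

text \<open>\<open>S\<^sup>k = S\<^sub>1\<^sup>k\<^sup>1 \<circ> \<dots> \<circ> S\<^sub>n\<^sup>k\<^sup>n\<close>: \<open>foldr\<close> applies the operator of the greatest index first.\<close>

definition S_pow ::
  "(real, 'n) vec \<Rightarrow> 'n::{finite,linorder} multi_index \<Rightarrow> ((real, 'n) vec \<Rightarrow> complex)
     \<Rightarrow> (real, 'n) vec \<Rightarrow> complex" where
  "S_pow \<mu> k \<phi> = foldr (\<lambda>i. S_op \<mu> i ^^ k i) (sorted_list_of_set UNIV) \<phi>"

definition S_pow_dual ::
  "(real, 'n) vec \<Rightarrow> 'n::{finite,linorder} multi_index \<Rightarrow> (((real, 'n) vec \<Rightarrow> complex) \<Rightarrow> complex)
     \<Rightarrow> ((real, 'n) vec \<Rightarrow> complex) \<Rightarrow> complex" where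
  "S_pow_dual \<mu> k f \<phi> = f (S_pow \<mu> k \<phi>)"

definition C_mu :: "real ^ 'n::finite \<Rightarrow> real" where
  "C_mu \<mu> = (\<Prod>i\<in>UNIV. 2 powr (\<mu> $ i) * Gamma (\<mu> $ i + 1))"

definition delta_mu :: "real ^ 'n::finite \<Rightarrow> (real ^ 'n \<Rightarrow> complex) \<Rightarrow> complex" where
  "delta_mu \<mu> \<phi> = of_real (C_mu \<mu>) * Lim (at 0 within orthant) (weighted \<mu> \<phi>)"

text \<open>Support relative to the open orthant.\<close>

definition orthant_supp :: "(real ^ 'n::finite \<Rightarrow> complex) \<Rightarrow> (real ^ 'n) set" where
  "orthant_supp \<phi> = orthant \<inter> closure {x \<in> orthant. \<phi> x \<noteq> 0}"

end

theory Submission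
  imports Defs
begin

text \<open>
  In the variables \<open>y\<^sub>i = x\<^sub>i\<^sup>2 / 2\<close> the operators \<open>T\<^sub>i\<close> are the partial derivatives, and
  \<open>\<phi>\<close> is replaced by \<open>w = x\<^bsup>-\<mu>-1/2\<^esup> \<phi>\<close>, all of whose derivatives extend continuously to the
  origin. Continuity bounds \<open>T\<close> by finitely many seminorms, of order at most \<open>N\<close> say. If
  the limits of \<open>T\<^sup>k w\<close> at the origin vanish for \<open>|k| \<le> N\<close>, then multiplying \<open>\<phi>\<close> by a cutoff
  function of \<open>\<parallel>x\<parallel>\<^sup>2 / q\<close> does not change \<open>T \<phi>\<close>, by the support hypothesis, while the seminorms
  become \<open>O(q)\<close>; hence \<open>T \<phi> = 0\<close>. So \<open>T\<close> vanishes on the common kernel of finitely many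
  functionals and is a linear combination of them. Finally \<open>S\<^sub>i\<close> acts on \<open>w\<close> as
  \<open>(2\<mu>\<^sub>i + 2) T\<^sub>i + x\<^sub>i\<^sup>2 T\<^sub>i\<^sup>2\<close>, so at the origin \<open>S\<^sup>k \<delta>\<^sub>\<mu>\<close> is a nonzero multiple of the limit of
  \<open>T\<^sup>k w\<close>.
\<close>

section \<open>Smooth functions and their partial derivatives\<close>

text \<open>Nothing is known about the boundary of the orthant, so there is no Taylor expansion at
  the origin to appeal to. Two facts that only use paths inside the orthant replace it. Boundedness
  of every iterated T_i w near 0 forces these functions to have limits there. If the limits vanish
  up to order N, integrating back from order N+1 gains a factor ||x||^2 for each order. The cutoff
  depends on ||x||^2 / q because ||x||^2 = 2(y_1 + ... + y_n) is linear in y: T_i differentiates the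
  profile and multiplies it by 2/q, without creating a singularity on the faces of the orthant.
  Continuity of the functional yields only |T \<phi>| < 1 on the common kernel. That kernel is
  closed under scaling, so the bound improves to T \<phi> = 0. Estimates are stated for words, that
  is, lists of indices read as compositions of T_i, since induction proceeds one letter at a time.
  Commutation of the T_i leads back to multi-indices.\<close>

lemma eventually_line_in_open:
  fixes x :: "real ^ 'n::finite"
  assumes "open U" "x \<in> U"
  shows "\<forall>\<^sub>F t in nhds 0. x + t *\<^sub>R axis i 1 \<in> U"
proof -
  have "((\<lambda>t. x + t *\<^sub>R axis i 1) \<longlongrightarrow> x + 0 *\<^sub>R axis i 1) (nhds 0)"
    by (intro tendsto_intros) (simp add: filterlim_ident)
  then show ?thesis
    using assms by (auto dest: topological_tendstoD)
qed

lemma partial_derivI: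
  "((\<lambda>t. f (x + t *\<^sub>R axis i 1)) has_vector_derivative D) (at 0) \<Longrightarrow> partial_deriv i f x = D"
  by (simp add: partial_deriv_def vector_derivative_at)

lemma has_vector_derivative_line_cong:
  fixes x :: "real ^ 'n::finite"
  assumes "open U" "x \<in> U" "\<And>y. y \<in> U \<Longrightarrow> f y = g y"
    and "((\<lambda>t. f (x + t *\<^sub>R axis i 1)) has_vector_derivative D) (at 0)"
  shows "((\<lambda>t. g (x + t *\<^sub>R axis i 1)) has_vector_derivative D) (at 0)"
proof -
  obtain e where "e > 0" and e: "\<And>t. dist t 0 < e \<Longrightarrow> x + t *\<^sub>R axis i 1 \<in> U"
    using eventually_line_in_open[OF assms(1,2), of i] unfolding eventually_nhds_metric by blast
  show ?thesis
    by (rule has_vector_derivative_transform_within_open[OF assms(4), of "ball 0 e"])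
      (use \<open>e > 0\<close> e assms(3) in \<open>auto simp: dist_commute\<close>)
qed

lemma partial_deriv_cong:
  fixes x :: "real ^ 'n::finite"
  assumes "open U" "x \<in> U" "\<And>y. y \<in> U \<Longrightarrow> f y = g y"
  shows "partial_deriv i f x = partial_deriv i g x"
proof -
  have "\<forall>\<^sub>F t in nhds 0. f (x + t *\<^sub>R axis i 1) = g (x + t *\<^sub>R axis i 1)"
    using eventually_line_in_open[OF assms(1,2), of i] by eventually_elim (rule assms(3))
  then show ?thesis
    unfolding partial_deriv_def by (intro vector_derivative_cong_eq) auto
qed

lemma differentiable_line_iff:
  "(\<lambda>t. f (x + t *\<^sub>R axis i 1)) differentiable at (0::real) \<longleftrightarrow>
   ((\<lambda>t. f (x + t *\<^sub>R axis i 1)) has_vector_derivative partial_deriv i f x) (at 0)"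
  unfolding partial_deriv_def vector_derivative_works ..

lemma C_k_on_cong:
  assumes "open U" "\<And>y. y \<in> U \<Longrightarrow> f y = g y" "C_k_on m U f"
  shows "C_k_on m U g"
  using assms(2,3)
proof (induction m arbitrary: f g)
  case 0
  then show ?case by (metis C_k_on.simps(1) continuous_on_cong)
next
  case (Suc m)
  have "C_k_on m U (partial_deriv i g)" for i
    by (rule Suc.IH[of "partial_deriv i f"])
      (use Suc.prems partial_deriv_cong[OF \<open>open U\<close>, of _ f g] in auto)
  moreover have "(\<lambda>t. g (x + t *\<^sub>R axis i 1)) differentiable at 0" if "x \<in> U" for x i
  proof -
    have "((\<lambda>t. f (x + t *\<^sub>R axis i 1)) has_vector_derivative partial_deriv i f x) (at 0)"
      using Suc.prems(2) that by (simp add: differentiable_line_iff)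
    from has_vector_derivative_line_cong[OF \<open>open U\<close> that Suc.prems(1) this]
    show ?thesis by (rule differentiableI_vector)
  qed
  moreover have "continuous_on U g"
    using Suc.prems by (metis C_k_on.simps(2) continuous_on_cong)
  ultimately show ?case by simp
qed

text \<open>Derivatives may be supplied by explicit formulas, so an induction on \<open>m\<close>
  can run over any family of functions closed under differentiation.\<close>

lemma C_k_on_SucI:
  assumes "open U" "continuous_on U f"
    and "\<And>i x. x \<in> U \<Longrightarrow> ((\<lambda>t. f (x + t *\<^sub>R axis i 1)) has_vector_derivative g i x) (at 0)"
    and "\<And>i. C_k_on m U (g i)"
  shows "C_k_on (Suc m) U f"
proof -
  have "C_k_on m U (partial_deriv i f)" for i
    by (rule C_k_on_cong[OF \<open>open U\<close> _ assms(4)[of i]]) (simp add: partial_derivI[OF assms(3)])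
  then show ?thesis
    using assms(2,3) by (auto intro: differentiableI_vector)
qed

lemma C_k_on_SucD: "C_k_on (Suc m) U f \<Longrightarrow> C_k_on m U f"
  by (induction m arbitrary: f) simp_all

lemma C_k_on_const: "C_k_on m U (\<lambda>x. c)"
proof (induction m arbitrary: c)
  case (Suc m)
  have "partial_deriv i (\<lambda>x. c) = (\<lambda>x. 0)" for i :: 'a
    by (rule ext, rule partial_derivI) (simp add: has_vector_derivative_const)
  with Suc show ?case by simp
qed simp

lemma C_k_on_add:
  assumes "open U" "C_k_on m U f" "C_k_on m U g"
  shows "C_k_on m U (\<lambda>x. f x + g x)"
  using assms(2,3)
proof (induction m arbitrary: f g)
  case 0
  then show ?case by (simp add: continuous_on_add)
next
  case (Suc m)
  show ?case
    by (rule C_k_on_SucI[OF \<open>open U\<close>, where g = "\<lambda>i x. partial_deriv i f x + partial_deriv i g x"])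
      (use Suc in \<open>auto simp: differentiable_line_iff
        intro!: continuous_on_add has_vector_derivative_add\<close>)
qed

lemma C_k_on_mult:
  assumes "open U" "C_k_on m U f" "C_k_on m U g"
  shows "C_k_on m U (\<lambda>x. f x * g x)"
  using assms(2,3)
proof (induction m arbitrary: f g)
  case 0
  then show ?case by (simp add: continuous_on_mult)
next
  case (Suc m)
  show ?case
  proof (rule C_k_on_SucI[OF \<open>open U\<close>,
        where g = "\<lambda>i x. f x * partial_deriv i g x + partial_deriv i f x * g x"])
    show "C_k_on m U (\<lambda>x. f x * partial_deriv i g x + partial_deriv i f x * g x)" for i
      using Suc.prems by (intro C_k_on_add[OF \<open>open U\<close>] Suc.IH) (auto intro: C_k_on_SucD)
    show "((\<lambda>t. f (x + t *\<^sub>R axis i 1) * g (x + t *\<^sub>R axis i 1)) has_vector_derivative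
        f x * partial_deriv i g x + partial_deriv i f x * g x) (at 0)" if "x \<in> U" for i x
      using has_vector_derivative_mult[of "\<lambda>t. f (x + t *\<^sub>R axis i 1)" _ 0 UNIV
          "\<lambda>t. g (x + t *\<^sub>R axis i 1)"] Suc.prems that
      by (simp add: differentiable_line_iff)
  qed (use Suc.prems in \<open>auto intro: continuous_on_mult\<close>)
qed

lemma C_infinity_on_iff:
  "C_infinity_on U f \<longleftrightarrow> continuous_on U f \<and>
     (\<forall>i. (\<forall>x\<in>U. (\<lambda>t. f (x + t *\<^sub>R axis i 1)) differentiable at 0) \<and>
          C_infinity_on U (partial_deriv i f))" (is "?L \<longleftrightarrow> ?R")
proof
  assume ?L
  then have "C_k_on (Suc m) U f" for m
    by (simp only: C_infinity_on_def)
  then show ?R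
    by (auto simp: C_infinity_on_def)
next
  assume R: ?R
  have "C_k_on m U f" for m
    using R by (cases m) (auto simp: C_infinity_on_def)
  then show ?L
    by (simp add: C_infinity_on_def)
qed

lemma C_infinity_on_continuous: "C_infinity_on U f \<Longrightarrow> continuous_on U f"
  by (subst (asm) C_infinity_on_iff) blast

lemma C_infinity_on_partial_deriv: "C_infinity_on U f \<Longrightarrow> C_infinity_on U (partial_deriv i f)"
  by (subst (asm) C_infinity_on_iff) blast

lemma has_vector_derivative_partial_deriv:
  assumes "C_infinity_on U f" "x \<in> U"
  shows "((\<lambda>t. f (x + t *\<^sub>R axis i 1)) has_vector_derivative partial_deriv i f x) (at 0)"
  using assms C_infinity_on_iff[of U f] by (simp add: differentiable_line_iff)

text \<open>Partial derivatives are defined through lines parametrised from their base point.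
  Translating the parameter gives the derivative at every point of a line, as the mean value theorem
  and integration require.\<close>

lemma has_vector_derivative_partial_deriv_at:
  assumes "C_infinity_on U f" "x + t *\<^sub>R axis i 1 \<in> U"
  shows "((\<lambda>t. f (x + t *\<^sub>R axis i 1)) has_vector_derivative
           partial_deriv i f (x + t *\<^sub>R axis i 1)) (at t within S)"
proof -
  have "((\<lambda>s. f (x + t *\<^sub>R axis i 1 + s *\<^sub>R axis i 1)) has_vector_derivative
           partial_deriv i f (x + t *\<^sub>R axis i 1)) (at (t - t))"
    using has_vector_derivative_partial_deriv[OF assms] by simp
  moreover have "((\<lambda>s. s - t) has_vector_derivative 1) (at t)"
    by (auto intro!: derivative_eq_intros simp: has_vector_derivative_def)
  ultimately have "((\<lambda>s. f (x + t *\<^sub>R axis i 1 + s *\<^sub>R axis i 1)) \<circ> (\<lambda>s. s - t) has_vector_derivative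
           1 *\<^sub>R partial_deriv i f (x + t *\<^sub>R axis i 1)) (at t)"
    by (intro vector_diff_chain_at)
  then have "((\<lambda>t. f (x + t *\<^sub>R axis i 1)) has_vector_derivative
           partial_deriv i f (x + t *\<^sub>R axis i 1)) (at t)"
    by (simp add: o_def algebra_simps)
  then show ?thesis
    by (rule has_vector_derivative_at_within)
qed

lemma C_infinity_on_cong:
  "open U \<Longrightarrow> (\<And>y. y \<in> U \<Longrightarrow> f y = g y) \<Longrightarrow> C_infinity_on U f \<Longrightarrow> C_infinity_on U g"
  unfolding C_infinity_on_def by (meson C_k_on_cong)

lemma C_infinity_on_const: "C_infinity_on U (\<lambda>x. c)"
  by (simp add: C_infinity_on_def C_k_on_const)

lemma C_infinity_on_add:
  "open U \<Longrightarrow> C_infinity_on U f \<Longrightarrow> C_infinity_on U g \<Longrightarrow> C_infinity_on U (\<lambda>x. f x + g x)"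
  by (simp add: C_infinity_on_def C_k_on_add)

lemma C_infinity_on_mult:
  "open U \<Longrightarrow> C_infinity_on U f \<Longrightarrow> C_infinity_on U g \<Longrightarrow> C_infinity_on U (\<lambda>x. f x * g x)"
  by (simp add: C_infinity_on_def C_k_on_mult)

lemma C_infinity_on_prod:
  assumes "open U" "\<And>i. i \<in> A \<Longrightarrow> C_infinity_on U (f i)"
  shows "C_infinity_on U (\<lambda>x. \<Prod>i\<in>A. f i x)"
  using assms(2)
  by (induction A rule: infinite_finite_induct)
    (auto intro: C_infinity_on_const C_infinity_on_mult[OF \<open>open U\<close>])

text \<open>Smoothness is defined by derivatives along axes only, so symmetry is derived from
  integration: f is written as an integral of its j-derivative, differentiated in direction i under
  the integral sign, and then differentiated in direction j by the fundamental theorem of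
  calculus.\<close>

lemma partial_deriv_commute:
  fixes f :: "real ^ 'n::finite \<Rightarrow> complex"
  assumes U: "open U" and f: "C_infinity_on U f" and x: "x \<in> U"
  shows "partial_deriv i (partial_deriv j f) x = partial_deriv j (partial_deriv i f) x"
proof -
  define ei ej :: "real ^ 'n" where "ei = axis i 1" and "ej = axis j 1"
  define p where "p s t = x + s *\<^sub>R ei + t *\<^sub>R ej" for s t
  have p_alt: "p s t = (x + t *\<^sub>R ej) + s *\<^sub>R ei" for s t
    by (simp add: p_def algebra_simps)
  have contp: "continuous_on UNIV (\<lambda>(s,t). p s t)"
    unfolding p_def case_prod_beta by (intro continuous_intros)
  have "open ((\<lambda>(s,t). p s t) -` U)"
    using U contp by (rule open_vimage)
  moreover have "(0,0) \<in> (\<lambda>(s,t). p s t) -` U"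
    using x by (simp add: p_def)
  ultimately obtain A B where AB: "open A" "open B" "0 \<in> A" "0 \<in> B" "A \<times> B \<subseteq> (\<lambda>(s,t). p s t) -` U"
    by (metis open_prod_elim mem_Sigma_iff)
  obtain d1 where d1: "d1 > 0" "cball 0 d1 \<subseteq> A"
    using AB open_contains_cball by metis
  obtain d2 where d2: "d2 > 0" "cball 0 d2 \<subseteq> B"
    using AB open_contains_cball by metis
  \<comment> \<open>The closed square of half-width \<open>d\<close> around \<open>x\<close> lies in
    \<open>U\<close>, and 0 is an interior point of the parameter interval, so one-sided problems
    with derivatives do not arise.\<close>
  define d where "d = min d1 d2"
  have d: "d > 0" using d1 d2 by (simp add: d_def)
  have pU: "p s t \<in> U" if "s \<in> {-d..d}" "t \<in> {-d..d}" for s t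
  proof -
    have "s \<in> A" "t \<in> B"
      using that d1 d2 by (auto simp: d_def dist_real_def subset_iff)
    then show "p s t \<in> U" using AB by auto
  qed
  let ?fi = "partial_deriv i f" and ?fj = "partial_deriv j f"
  let ?fij = "partial_deriv i ?fj"
  have Cs: "C_infinity_on U ?fi" "C_infinity_on U ?fj" "C_infinity_on U ?fij"
    using f by (auto intro: C_infinity_on_partial_deriv)
  have contpI: "continuous_on S (\<lambda>y. h (p (a y) (b y)))"
    if "C_infinity_on U h" "continuous_on S a" "continuous_on S b"
      "\<And>y. y \<in> S \<Longrightarrow> a y \<in> {-d..d} \<and> b y \<in> {-d..d}" for h S and a b :: "'x::topological_space \<Rightarrow> real"
  proof (rule continuous_on_compose2[OF C_infinity_on_continuous[OF that(1)]])
    show "continuous_on S (\<lambda>y. p (a y) (b y))"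
      unfolding p_def using that by (intro continuous_intros)
  qed (use pU that in auto)
  have Ds: "((\<lambda>s. h (p s t)) has_vector_derivative partial_deriv i h (p s t)) (at s within S)"
    if "C_infinity_on U h" "s \<in> {-d..d}" "t \<in> {-d..d}" for h s t S
    using has_vector_derivative_partial_deriv_at[OF that(1), of "x + t *\<^sub>R ej" s i] pU[OF that(2,3)]
    unfolding p_alt ei_def by simp
  have Dt: "((\<lambda>t. h (p s t)) has_vector_derivative partial_deriv j h (p s t)) (at t within S)"
    if "C_infinity_on U h" "s \<in> {-d..d}" "t \<in> {-d..d}" for h s t S
    using has_vector_derivative_partial_deriv_at[OF that(1), of "x + s *\<^sub>R ei" t j] pU[OF that(2,3)]
    unfolding p_def ej_def by simp
  \<comment> \<open>The integral runs in direction j alone; \<open>s\<close> enters as a parameter,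
    which makes the Leibniz rule applicable.\<close>
  have FTC: "f (p s t) = f (p s (-d)) + integral {-d..t} (\<lambda>u. ?fj (p s u))"
    if "s \<in> {-d..d}" "t \<in> {-d..d}" for s t
  proof -
    have "((\<lambda>u. ?fj (p s u)) has_integral (f (p s t) - f (p s (-d)))) {-d..t}"
      by (rule fundamental_theorem_of_calculus) (use that in \<open>auto intro!: Dt f\<close>)
    then show ?thesis by (simp add: integral_unique)
  qed
  have key: "?fi (p 0 t) = ?fi (p 0 (-d)) + integral {-d..t} (\<lambda>u. ?fij (p 0 u))"
    if t: "t \<in> {-d..d}" for t
  proof -
    have "((\<lambda>s. integral (cbox (-d) t) (\<lambda>u. ?fj (p s u))) has_vector_derivative
        integral (cbox (-d) t) (\<lambda>u. ?fij (p 0 u))) (at 0 within {-d..d})"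
    proof (rule leibniz_rule_vector_derivative)
      show "(\<lambda>u. ?fj (p s u)) integrable_on cbox (- d) t" if "s \<in> {-d..d}" for s
        using that t by (intro integrable_continuous contpI Cs continuous_intros) auto
      show "continuous_on ({- d..d} \<times> cbox (- d) t) (\<lambda>(s, t). ?fij (p s t))"
        unfolding case_prod_beta
        using t by (intro contpI Cs continuous_intros) auto
    qed (use d t in \<open>auto intro!: Ds Cs\<close>)
    then have "((\<lambda>s. f (p s (-d)) + integral {-d..t} (\<lambda>u. ?fj (p s u))) has_vector_derivative
        ?fi (p 0 (-d)) + integral {-d..t} (\<lambda>u. ?fij (p 0 u))) (at 0 within {-d..d})"
      using d by (intro has_vector_derivative_add Ds f) auto
    then have "((\<lambda>s. f (p s t)) has_vector_derivative
        ?fi (p 0 (-d)) + integral {-d..t} (\<lambda>u. ?fij (p 0 u))) (at 0 within {-d..d})"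
      by (rule has_vector_derivative_transform[rotated 2]) (use d t in \<open>auto intro: FTC\<close>)
    moreover have "((\<lambda>s. f (p s t)) has_vector_derivative ?fi (p 0 t)) (at 0 within {-d..d})"
      using d t by (intro Ds f) auto
    ultimately show ?thesis
      using d by (intro vector_derivative_unique_within[rotated])
        (auto simp: trivial_limit_within islimpt_Icc)
  qed
  \<comment> \<open>By \<open>key\<close> this is the function t to ?fi (p 0 t), so its derivative
    at 0 can be read off in two ways.\<close>
  have "((\<lambda>t. ?fi (p 0 (-d)) + integral {-d..t} (\<lambda>u. ?fij (p 0 u))) has_vector_derivative
      0 + ?fij (p 0 0)) (at 0 within {-d..d})"
    using d by (intro has_vector_derivative_add has_vector_derivative_const
        integral_has_vector_derivative contpI Cs continuous_intros) auto
  then have "((\<lambda>t. ?fi (p 0 t)) has_vector_derivative 0 + ?fij (p 0 0)) (at 0 within {-d..d})"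
    by (rule has_vector_derivative_transform[rotated 2]) (use d in \<open>auto intro: key\<close>)
  moreover have "((\<lambda>t. ?fi (p 0 t)) has_vector_derivative partial_deriv j ?fi (p 0 0)) (at 0 within {-d..d})"
    using d by (intro Dt Cs) auto
  ultimately have "0 + ?fij (p 0 0) = partial_deriv j ?fi (p 0 0)"
    using d by (intro vector_derivative_unique_within[rotated])
        (auto simp: trivial_limit_within islimpt_Icc)
  then show ?thesis
    by (simp add: p_def)
qed

section \<open>The operators \<open>T\<^sub>i\<close> on the orthant\<close>

lemma open_orthant: "open (orthant :: (real ^ 'n::finite) set)"
proof -
  have eq: "orthant = (\<Inter>i::'n. {x. 0 < x $ i})"
    by (auto simp: orthant_def)
  have "open {x :: real ^ 'n. 0 < x $ i}" for i
    by (intro open_Collect_less continuous_intros)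
  then show ?thesis
    unfolding eq by (intro open_INT) auto
qed

lemma orthantD: "x \<in> orthant \<Longrightarrow> 0 < x $ i"
  by (simp add: orthant_def)

lemma orthantD_neq: "x \<in> orthant \<Longrightarrow> x $ i \<noteq> 0"
  using orthantD[of x i] by simp

lemma orthantD_abs: "x \<in> orthant \<Longrightarrow> \<bar>x $ i\<bar> = x $ i"
  using orthantD[of x i] by simp

lemma C_k_on_coord:
  fixes U :: "(real ^ 'n::finite) set"
  assumes "open U"
  shows "C_k_on m U (\<lambda>x. complex_of_real (x $ i))"
proof (cases m)
  case (Suc m)
  have "((\<lambda>t. complex_of_real ((x + t *\<^sub>R axis j 1) $ i)) has_vector_derivative
      (if j = i then 1 else 0)) (at 0)" for x :: "real ^ 'n" and j
    by (auto intro!: derivative_eq_intros simp: axis_def has_vector_derivative_of_real)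
  then show ?thesis
    unfolding Suc by (intro C_k_on_SucI[OF assms]) (auto intro!: continuous_intros C_k_on_const)
qed (auto intro!: continuous_intros)

lemma C_infinity_on_coord: "open U \<Longrightarrow> C_infinity_on U (\<lambda>x. complex_of_real (x $ i))"
  by (simp add: C_infinity_on_def C_k_on_coord)

lemma has_vector_derivative_coord_powr:
  assumes "x \<in> orthant"
  shows "((\<lambda>t. complex_of_real ((x + t *\<^sub>R axis j 1) $ i powr a)) has_vector_derivative
     complex_of_real (if j = i then a * x $ i powr (a - 1) else 0)) (at 0)"
proof -
  have "((\<lambda>t. (x + t *\<^sub>R axis j 1) $ i powr a) has_real_derivative
     (if j = i then a * x $ i powr (a - 1) else 0)) (at 0)"
    using orthantD[OF assms, of i] by (auto intro!: derivative_eq_intros simp: axis_def)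
  then show ?thesis
    by (intro has_vector_derivative_of_real) (simp add: has_real_derivative_iff_has_vector_derivative)
qed

lemma C_k_on_coord_powr: "C_k_on m orthant (\<lambda>x. complex_of_real (x $ i powr a))"
proof (induction m arbitrary: a)
  case 0
  show ?case
    by (auto intro!: continuous_intros simp: orthantD_neq)
next
  case (Suc m)
  show ?case
  proof (rule C_k_on_SucI[OF open_orthant _ has_vector_derivative_coord_powr])
    show "continuous_on orthant (\<lambda>x. complex_of_real (x $ i powr a))"
      by (auto intro!: continuous_intros simp: orthantD_neq)
    show "C_k_on m orthant (\<lambda>x. complex_of_real (if j = i then a * x $ i powr (a - 1) else 0))" for j
      using C_k_on_mult[OF open_orthant C_k_on_const[of m orthant "of_real a"] Suc.IH[of "a - 1"]]
      by (cases "j = i") (auto simp: C_k_on_const)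
  qed
qed

lemma C_infinity_on_coord_powr: "C_infinity_on orthant (\<lambda>x. complex_of_real (x $ i powr a))"
  by (simp add: C_infinity_on_def C_k_on_coord_powr)

lemma C_infinity_on_vec_powr: "C_infinity_on orthant (\<lambda>x. complex_of_real (vec_powr x a))"
  unfolding vec_powr_def of_real_prod
  by (intro C_infinity_on_prod open_orthant C_infinity_on_coord_powr)

lemma C_infinity_on_weighted: "C_infinity_on orthant \<phi> \<Longrightarrow> C_infinity_on orthant (weighted \<mu> \<phi>)"
  unfolding weighted_def scaleR_conv_of_real
  by (intro C_infinity_on_mult open_orthant C_infinity_on_vec_powr)

lemma C_infinity_on_T_op:
  assumes "C_infinity_on orthant f"
  shows "C_infinity_on orthant (T_op i f)"
proof (rule C_infinity_on_cong[OF open_orthant])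
  show "C_infinity_on orthant (\<lambda>x. complex_of_real (x $ i powr (-1)) * partial_deriv i f x)"
    using assms by (intro C_infinity_on_mult open_orthant C_infinity_on_coord_powr C_infinity_on_partial_deriv)
next
  fix y :: "real ^ 'a" assume "y \<in> orthant"
  then show "complex_of_real (y $ i powr (-1)) * partial_deriv i f y = T_op i f y"
    using orthantD[of y i] by (simp add: T_op_def scaleR_conv_of_real powr_minus)
qed

lemma partial_deriv_eq_T_op: "x \<in> orthant \<Longrightarrow> partial_deriv i f x = of_real (x $ i) * T_op i f x"
  using orthantD[of x i] by (simp add: T_op_def scaleR_conv_of_real)

lemma T_op_cong:
  assumes "x \<in> orthant" "\<And>y. y \<in> orthant \<Longrightarrow> f y = g y"
  shows "T_op i f x = T_op i g x"
  unfolding T_op_def using partial_deriv_cong[OF open_orthant assms(1), of f g] assms by simp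

lemma T_op_eqI:
  assumes "((\<lambda>t. f (x + t *\<^sub>R axis i 1)) has_vector_derivative D) (at 0)"
  shows "T_op i f x = inverse (x $ i) *\<^sub>R D"
  unfolding T_op_def partial_derivI[OF assms] ..

lemma T_op_add:
  assumes "C_infinity_on orthant f" "C_infinity_on orthant g" "x \<in> orthant"
  shows "T_op i (\<lambda>x. f x + g x) x = T_op i f x + T_op i g x"
proof -
  have "((\<lambda>t. f (x + t *\<^sub>R axis i 1) + g (x + t *\<^sub>R axis i 1)) has_vector_derivative
      partial_deriv i f x + partial_deriv i g x) (at 0)"
    using assms by (intro has_vector_derivative_add has_vector_derivative_partial_deriv)
  from T_op_eqI[OF this] show ?thesis
    by (simp add: T_op_def scaleR_add_right)
qed

lemma T_op_mult:
  assumes "C_infinity_on orthant f" "C_infinity_on orthant g" "x \<in> orthant"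
  shows "T_op i (\<lambda>x. f x * g x) x = T_op i f x * g x + f x * T_op i g x"
proof -
  have "((\<lambda>t. f (x + t *\<^sub>R axis i 1) * g (x + t *\<^sub>R axis i 1)) has_vector_derivative
      f x * partial_deriv i g x + partial_deriv i f x * g x) (at 0)"
    using has_vector_derivative_mult[OF has_vector_derivative_partial_deriv[OF assms(1,3), of i]
        has_vector_derivative_partial_deriv[OF assms(2,3), of i]]
    by simp
  from T_op_eqI[OF this] show ?thesis
    by (simp add: T_op_def scaleR_add_right)
qed

lemma T_op_const: "T_op i (\<lambda>x. c) x = 0"
  using T_op_eqI[of "\<lambda>x. c" x i 0] by (simp add: has_vector_derivative_const)

lemma T_op_coord_powr:
  assumes "x \<in> orthant"
  shows "T_op j (\<lambda>x. complex_of_real (x $ i powr a)) x =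
    (if j = i then of_real (a * x $ i powr (a - 2)) else 0)"
  using T_op_eqI[OF has_vector_derivative_coord_powr[OF assms, where j = j and i = i and a = a]]
    orthantD[OF assms, of i]
  by (simp add: scaleR_conv_of_real powr_diff power2_eq_square field_simps)

lemma T_op_coord_sq:
  fixes x :: "real ^ 'n::finite"
  assumes "x \<in> orthant"
  shows "T_op j (\<lambda>x. complex_of_real ((x $ i)\<^sup>2)) x = (if j = i then 2 else 0)"
proof -
  have "T_op j (\<lambda>x. complex_of_real ((x $ i)\<^sup>2)) x = T_op j (\<lambda>x. complex_of_real (x $ i powr 2)) x"
  proof (rule T_op_cong[OF assms])
    fix y :: "real ^ 'n" assume "y \<in> orthant"
    then show "complex_of_real ((y $ i)\<^sup>2) = complex_of_real (y $ i powr 2)"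
      using orthantD[of y i] by simp
  qed
  then show ?thesis
    using orthantD[OF assms, of i] by (simp add: T_op_coord_powr[OF assms])
qed

text \<open>For distinct indices the factor 1/x_j is constant in direction i and can be pulled out,
  which reduces the claim to the symmetry of mixed partial derivatives.\<close>

lemma T_op_commute:
  assumes "C_infinity_on orthant f" "x \<in> orthant"
  shows "T_op i (T_op j f) x = T_op j (T_op i f) x"
proof (cases "i = j")
  case False
  have *: "T_op i (T_op j f) x = of_real (inverse (x $ i) * inverse (x $ j)) *
      partial_deriv i (partial_deriv j f) x" if "i \<noteq> j" for i j
  proof -
    have "T_op i (T_op j f) x = T_op i (\<lambda>y. of_real (y $ j powr (-1)) * partial_deriv j f y) x"
      by (rule T_op_cong[OF assms(2)])
        (auto simp: T_op_def[of j] scaleR_conv_of_real powr_minus orthantD_abs)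
    also have "\<dots> = of_real (x $ j powr (-1)) * T_op i (partial_deriv j f) x"
      using T_op_mult[OF C_infinity_on_coord_powr[of j "-1"]
          C_infinity_on_partial_deriv[OF assms(1), of j] assms(2), of i]
        T_op_coord_powr[OF assms(2), of i j "-1"] that
      by (simp only: if_False mult_zero_left add_0)
    also have "\<dots> = of_real (inverse (x $ i) * inverse (x $ j)) * partial_deriv i (partial_deriv j f) x"
      using orthantD[OF assms(2), of j] by (simp add: T_op_def scaleR_conv_of_real powr_minus less_imp_le)
    finally show ?thesis .
  qed
  show ?thesis
    using *[OF False] *[OF False[symmetric]] partial_deriv_commute[OF open_orthant assms, of i j]
    by (simp add: mult.commute)
qed simp

section \<open>Words in the operators T_i and their relation to multi-indices\<close>

lemma fold_T_op_C_infinity: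
  "C_infinity_on orthant f \<Longrightarrow> C_infinity_on orthant (fold T_op u f)"
  by (induction u arbitrary: f) (auto intro: C_infinity_on_T_op)

lemma fold_T_op_cong:
  assumes "\<And>y. y \<in> orthant \<Longrightarrow> f y = g y" "x \<in> orthant"
  shows "fold T_op u f x = fold T_op u g x"
  using assms(1)
proof (induction u arbitrary: f g)
  case (Cons i u)
  show ?case
    unfolding fold_simps by (intro Cons.IH T_op_cong Cons.prems)
qed (use assms in simp)

lemma fold_T_op_add:
  assumes "C_infinity_on orthant f" "C_infinity_on orthant g" "x \<in> orthant"
  shows "fold T_op u (\<lambda>x. f x + g x) x = fold T_op u f x + fold T_op u g x"
  using assms(1,2)
proof (induction u arbitrary: f g)
  case (Cons i u)
  have "fold T_op u (T_op i (\<lambda>x. f x + g x)) x = fold T_op u (\<lambda>x. T_op i f x + T_op i g x) x"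
    by (rule fold_T_op_cong[OF _ assms(3)]) (simp add: T_op_add Cons.prems)
  with Cons show ?case
    by (simp add: C_infinity_on_T_op)
qed simp

lemma fold_T_op_cmult:
  assumes "C_infinity_on orthant f" "x \<in> orthant"
  shows "fold T_op u (\<lambda>x. c * f x) x = c * fold T_op u f x"
  using assms(1)
proof (induction u arbitrary: f)
  case (Cons i u)
  have "fold T_op u (T_op i (\<lambda>x. c * f x)) x = fold T_op u (\<lambda>x. c * T_op i f x) x"
    by (rule fold_T_op_cong[OF _ assms(2)])
      (simp add: T_op_mult Cons.prems C_infinity_on_const T_op_const)
  with Cons show ?case
    by (simp add: C_infinity_on_T_op)
qed simp

lemma T_op_fold_commute:
  assumes "C_infinity_on orthant f" "x \<in> orthant"
  shows "T_op i (fold T_op u f) x = fold T_op u (T_op i f) x"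
  using assms(1)
proof (induction u arbitrary: f)
  case (Cons j u)
  have "T_op i (fold T_op (j # u) f) x = fold T_op u (T_op i (T_op j f)) x"
    using Cons by (simp add: C_infinity_on_T_op)
  also have "\<dots> = fold T_op u (T_op j (T_op i f)) x"
    by (rule fold_T_op_cong[OF _ assms(2)]) (simp add: T_op_commute Cons.prems)
  finally show ?case by simp
qed simp

text \<open>Since the T_i commute on smooth functions, the first letter of one word can be moved to
  the front of the other. Hence only the number of occurrences of each letter matters, and
  statements about multi-indices transfer to arbitrary words.\<close>

lemma fold_T_op_perm:
  assumes "mset u = mset v" "C_infinity_on orthant f" "x \<in> orthant"
  shows "fold T_op u f x = fold T_op v f x"
  using assms(1,2)
proof (induction u arbitrary: v f)
  case (Cons i u)
  then have "i \<in> set v"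
    by (metis list.set_intros(1) mset_eq_setD)
  then obtain v1 v2 where v: "v = v1 @ i # v2"
    by (auto simp: in_set_conv_decomp)
  with Cons.prems have "mset u = mset (v1 @ v2)"
    by simp
  have "fold T_op v f x = fold T_op v2 (T_op i (fold T_op v1 f)) x"
    by (simp add: v)
  also have "\<dots> = fold T_op v2 (fold T_op v1 (T_op i f)) x"
    by (rule fold_T_op_cong[OF _ assms(3)]) (simp add: T_op_fold_commute Cons.prems)
  also have "\<dots> = fold T_op u (T_op i f) x"
    using Cons.IH[OF \<open>mset u = mset (v1 @ v2)\<close>, of "T_op i f"] Cons.prems
    by (simp add: C_infinity_on_T_op)
  finally show ?case by simp
qed simp

text \<open>The sorted word with k_i letters i. Read by \<open>fold\<close> it gives T^k, and read
  by \<open>foldr\<close> it gives S^k, in the prescribed orders of composition.\<close>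

definition mi_word :: "'n::{finite,linorder} multi_index \<Rightarrow> 'n list" where
  "mi_word k = concat (map (\<lambda>i. replicate (k i) i) (sorted_list_of_set UNIV))"

lemma fold_replicate_funpow: "fold f (replicate n x) = f x ^^ n"
  by (induction n) (auto simp: funpow_swap1 fun_eq_iff)

lemma T_pow_eq_fold: "T_pow k f = fold T_op (mi_word k) f"
proof -
  have "fold (\<lambda>i. T_op i ^^ k i) xs f = fold T_op (concat (map (\<lambda>i. replicate (k i) i) xs)) f" for xs
    by (induction xs arbitrary: f) (auto simp: fold_replicate_funpow)
  then show ?thesis
    by (simp add: T_pow_def mi_word_def)
qed

lemma foldr_replicate_funpow: "foldr f (replicate n x) = f x ^^ n"
  by (induction n) auto

lemma S_pow_eq_foldr: "S_pow \<mu> k \<phi> = foldr (S_op \<mu>) (mi_word k) \<phi>"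
proof -
  have "foldr (\<lambda>i. S_op \<mu> i ^^ k i) xs \<phi> = foldr (S_op \<mu>) (concat (map (\<lambda>i. replicate (k i) i) xs)) \<phi>" for xs
    by (induction xs) (auto simp: foldr_replicate_funpow)
  then show ?thesis
    by (simp add: S_pow_def mi_word_def)
qed

lemma length_mi_word: "length (mi_word k) = mi_abs k"
proof -
  have "sum_list (map k (sorted_list_of_set UNIV)) = sum k UNIV"
    by (simp add: sum_list_distinct_conv_sum_set)
  then show ?thesis
    by (simp add: mi_word_def mi_abs_def length_concat o_def)
qed

lemma mset_mi_word_count: "mset (mi_word (count (mset u))) = mset u"
proof (rule multiset_eqI)
  fix i :: 'a
  have "count (mset (concat (map (\<lambda>i. replicate (count (mset u) i) i) xs))) i =
      (if i \<in> set xs then count (mset u) i else 0)" if "distinct xs" for xs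
    using that by (induction xs) auto
  then show "count (mset (mi_word (count (mset u)))) i = count (mset u) i"
    by (simp add: mi_word_def)
qed

section \<open>Limits at the origin\<close>

text \<open>One coordinate at a time is changed from x to z. All points met on the way have positive
  coordinates bounded by those of x and z, so the path stays in the orthant and derivative bounds
  are needed only below the coordinatewise maximum.\<close>

lemma norm_diff_le_partial_derivs:
  assumes h: "C_infinity_on orthant h" and x: "x \<in> orthant" and z: "z \<in> orthant"
    and bound: "\<And>y i. y \<in> orthant \<Longrightarrow> (\<And>j. y $ j \<le> max (x $ j) (z $ j)) \<Longrightarrow>
      norm (partial_deriv i h y) \<le> B"
  shows "norm (h x - h z) \<le> (\<Sum>i\<in>UNIV. \<bar>x $ i - z $ i\<bar>) * B"
proof -
  \<comment> \<open>The corner of the path at which exactly the coordinates in \<open>A\<close> have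
    been switched to those of \<open>z\<close>.\<close>
  define p where "p A = (\<chi> i. if i \<in> A then z $ i else x $ i)" for A
  have "norm (h x - h (p A)) \<le> (\<Sum>i\<in>A. \<bar>x $ i - z $ i\<bar>) * B" if "finite A" for A
    using that
  proof (induction A rule: finite_induct)
    case empty
    then show ?case by (simp add: p_def)
  next
    case (insert i A)
    define d where "d = z $ i - x $ i"
    define S where "S = closed_segment 0 d"
    define f where "f t = h (p A + t *\<^sub>R axis i 1)" for t
    have p_insert: "p (insert i A) = p A + d *\<^sub>R axis i 1"
      using insert.hyps by (auto simp: p_def d_def vec_eq_iff axis_def)
    have on_path: "p A + t *\<^sub>R axis i 1 \<in> orthant"
      "(p A + t *\<^sub>R axis i 1) $ j \<le> max (x $ j) (z $ j)" if "t \<in> S" for t j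
    proof -
      have t: "min (x $ i) (z $ i) \<le> x $ i + t" "x $ i + t \<le> max (x $ i) (z $ i)"
        using that by (auto simp: S_def d_def closed_segment_eq_real_ivl split: if_splits)
      show "(p A + t *\<^sub>R axis i 1) $ j \<le> max (x $ j) (z $ j)"
        using t insert.hyps by (auto simp: p_def axis_def)
      have "0 < x $ i + t"
        using t(1) orthantD[OF x, of i] orthantD[OF z, of i] by (auto simp: min_def split: if_splits)
      then show "p A + t *\<^sub>R axis i 1 \<in> orthant"
        using insert.hyps orthantD[OF x] orthantD[OF z] by (auto simp: orthant_def p_def axis_def)
    qed
    have "norm (f 0 - f d) \<le> B * norm (0 - d)"
    proof (rule differentiable_bound[of S])
      show "(f has_derivative (\<lambda>s. s *\<^sub>R partial_deriv i h (p A + t *\<^sub>R axis i 1))) (at t within S)"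
        if "t \<in> S" for t
        using has_vector_derivative_partial_deriv_at[OF h on_path(1)[OF that]]
        unfolding f_def has_vector_derivative_def .
      show "onorm (\<lambda>s. s *\<^sub>R partial_deriv i h (p A + t *\<^sub>R axis i 1)) \<le> B" if "t \<in> S" for t
        using bound[OF on_path(1)[OF that] on_path(2)[OF that], of i]
        by (intro onorm_le) (auto simp: mult.commute[of B] intro: mult_left_mono)
    qed (auto simp: S_def)
    then have "norm (h (p A) - h (p (insert i A))) \<le> \<bar>x $ i - z $ i\<bar> * B"
      by (simp add: f_def p_insert d_def mult.commute abs_minus_commute)
    moreover have "norm (h x - h (p (insert i A))) \<le>
        norm (h x - h (p A)) + norm (h (p A) - h (p (insert i A)))"
      by (rule norm_triangle_le_diff[of "h x - h (p A)" "h (p (insert i A)) - h (p A)", simplified])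
         (simp add: norm_minus_commute)
    ultimately show ?case
      using insert by (simp add: algebra_simps)
  qed
  from this[of UNIV] show ?thesis
    by (simp add: p_def)
qed

lemma norm_le_norm_orthant:
  "y \<in> orthant \<Longrightarrow> (\<And>i. y $ i \<le> x $ i) \<Longrightarrow> norm y \<le> norm x"
  by (rule norm_le_componentwise_cart) (smt (verit) orthantD real_norm_def)

lemma orthant_small:
  assumes "e > 0"
  shows "\<exists>x\<in>orthant. norm (x :: real ^ 'n::finite) < e"
proof
  define d where "d = e / (2 * CARD('n))"
  have "d > 0" using assms by (simp add: d_def)
  then show "(\<chi> i::'n. d) \<in> orthant" by (simp add: orthant_def)
  have "norm (\<chi> i::'n. d) \<le> (\<Sum>i\<in>(UNIV::'n set). \<bar>(\<chi> i::'n. d) $ i\<bar>)"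
    by (rule norm_le_l1_cart)
  also have "\<dots> = e / 2" using \<open>e > 0\<close> by (simp add: d_def)
  finally show "norm (\<chi> i::'n. d) < e" using assms by simp
qed

text \<open>Uniqueness of limits at the origin depends on this; it lets \<open>Lim\<close> in
  \<open>delta_mu\<close> be evaluated.\<close>

lemma at_0_within_orthant_neq_bot: "at (0 :: real ^ 'n::finite) within orthant \<noteq> bot"
proof -
  have "(0 :: real ^ 'n) islimpt orthant"
    unfolding islimpt_approachable
  proof (intro allI impI)
    fix e :: real assume "e > 0"
    then obtain x :: "real ^ 'n" where "x \<in> orthant" "norm x < e"
      using orthant_small by blast
    then show "\<exists>x\<in>orthant. x \<noteq> (0 :: real ^ 'n) \<and> dist x 0 < e"
      by (intro bexI[of _ x]) (auto simp: orthant_def)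
  qed
  then show ?thesis
    by (simp add: trivial_limit_within)
qed

text \<open>In the variables \<open>y\<^sub>i = x\<^sub>i\<^sup>2 / 2\<close>: all partial derivatives are bounded near \<open>0\<close>.\<close>

definition T_regular :: "(real ^ 'n::finite \<Rightarrow> complex) \<Rightarrow> bool" where
  "T_regular h \<longleftrightarrow> C_infinity_on orthant h \<and>
     (\<forall>u. \<exists>B. \<forall>x\<in>orthant. norm x \<le> 1 \<longrightarrow> norm (fold T_op u h x) \<le> B)"

lemma T_regular_C_infinity: "T_regular h \<Longrightarrow> C_infinity_on orthant h"
  by (simp add: T_regular_def)

text \<open>There are finitely many words of length at most N over a finite alphabet, so one
  constant serves them all.\<close>

lemma T_regularD:
  assumes "T_regular h"
  obtains B where "B \<ge> 0"
    "\<And>u x. length u \<le> N \<Longrightarrow> x \<in> orthant \<Longrightarrow> norm x \<le> 1 \<Longrightarrow> norm (fold T_op u h x) \<le> B"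
proof -
  obtain b where b: "\<And>u x. x \<in> orthant \<Longrightarrow> norm x \<le> 1 \<Longrightarrow> norm (fold T_op u h x) \<le> b u"
    using assms unfolding T_regular_def by metis
  have fin: "finite {u :: 'a list. set u \<subseteq> UNIV \<and> length u \<le> N}"
    by (rule finite_lists_length_le) simp
  show ?thesis
  proof (rule that[of "\<Sum>u | set u \<subseteq> UNIV \<and> length u \<le> N. \<bar>b u\<bar>"])
    show "norm (fold T_op u h x) \<le> (\<Sum>u | set u \<subseteq> UNIV \<and> length u \<le> N. \<bar>b u\<bar>)"
      if "length u \<le> N" "x \<in> orthant" "norm x \<le> 1" for u x
    proof -
      have "norm (fold T_op u h x) \<le> \<bar>b u\<bar>"
        using b[OF that(2,3), of u] by simp
      also have "\<dots> \<le> (\<Sum>u | set u \<subseteq> UNIV \<and> length u \<le> N. \<bar>b u\<bar>)"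
        by (rule member_le_sum) (use that fin in auto)
      finally show ?thesis .
    qed
  qed (simp add: sum_nonneg)
qed

lemma T_regular_fold_T_op: "T_regular h \<Longrightarrow> T_regular (fold T_op u h)"
  unfolding T_regular_def by (metis fold_T_op_C_infinity fold_append comp_apply)

lemma T_regular_T_op: "T_regular h \<Longrightarrow> T_regular (T_op i h)"
  using T_regular_fold_T_op[of h "[i]"] by simp

text \<open>The partial derivatives x_i T_i h are bounded near 0, hence h is Lipschitz there. A
  uniformly continuous function extends to the closure of its domain, and that closure contains the
  origin.\<close>

lemma T_regular_limit:
  fixes h :: "real ^ 'n::finite \<Rightarrow> complex"
  assumes "T_regular h"
  shows "\<exists>l. (h \<longlongrightarrow> l) (at 0 within orthant)"
proof -
  obtain B where "B \<ge> 0" and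
    B: "\<And>u x. length u \<le> 1 \<Longrightarrow> x \<in> orthant \<Longrightarrow> norm x \<le> 1 \<Longrightarrow> norm (fold T_op u h x) \<le> B"
    using T_regularD[OF assms, of 1] by metis
  \<comment> \<open>Points on the path between x and z lie coordinatewise below x + z. Radius 1/2
    therefore keeps them in the unit ball, where the bound \<open>B\<close> holds.\<close>
  define X where "X = orthant \<inter> ball (0 :: real ^ 'n) (1/2)"
  have "(CARD('n) * B)-lipschitz_on X h"
  proof (rule lipschitz_onI)
    fix x z assume xz: "x \<in> X" "z \<in> X"
    then have xz': "x \<in> orthant" "z \<in> orthant" "norm x \<le> 1/2" "norm z \<le> 1/2"
      by (auto simp: X_def)
    have "norm (h x - h z) \<le> (\<Sum>i\<in>UNIV. \<bar>x $ i - z $ i\<bar>) * B"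
    proof (rule norm_diff_le_partial_derivs[OF T_regular_C_infinity[OF assms] xz'(1,2)])
      fix y i assume y: "y \<in> orthant" "\<And>j. y $ j \<le> max (x $ j) (z $ j)"
      have "y $ j \<le> (x + z) $ j" for j
        using y(2)[of j] orthantD[OF xz'(1), of j] orthantD[OF xz'(2), of j] by auto
      then have "norm y \<le> norm (x + z)"
        by (rule norm_le_norm_orthant[OF y(1)])
      then have y1: "norm y \<le> 1"
        using norm_triangle_ineq[of x z] xz' by simp
      then have "\<bar>y $ i\<bar> \<le> 1" "norm (T_op i h y) \<le> B"
        using B[of "[i]"] y component_le_norm_cart[of y i] by auto
      then show "norm (partial_deriv i h y) \<le> B"
        using mult_mono[of "\<bar>y $ i\<bar>" 1 "norm (T_op i h y)" B]
        by (simp add: partial_deriv_eq_T_op y norm_mult)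
    qed
    also have "\<dots> \<le> (\<Sum>i\<in>(UNIV::'n set). norm (x - z)) * B"
      using component_le_norm_cart[of "x - z"] \<open>B \<ge> 0\<close>
      by (intro mult_right_mono sum_mono) auto
    finally show "dist (h x) (h z) \<le> CARD('n) * B * dist x z"
      by (simp add: dist_norm algebra_simps)
  qed (use \<open>B \<ge> 0\<close> in simp)
  then have uc: "uniformly_continuous_on X h"
    by (rule lipschitz_on_uniformly_continuous)
  have "0 \<in> closure X"
    unfolding closure_approachable
  proof (intro allI impI)
    fix e :: real assume "e > 0"
    then obtain x :: "real ^ 'n" where "x \<in> orthant" "norm x < min e (1/2)"
      using orthant_small[of "min e (1/2)"] by auto
    then show "\<exists>y\<in>X. dist y 0 < e"
      by (intro bexI[of _ x]) (auto simp: X_def)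
  qed
  with uc obtain l where "(h \<longlongrightarrow> l) (at 0 within X)"
    by (rule uniformly_continuous_on_extension_at_closure)
  moreover have "at 0 within X = at 0 within orthant"
    by (rule at_within_nhd[of _ "ball 0 (1/2)"]) (auto simp: X_def)
  ultimately show ?thesis by auto
qed

definition origin_lim :: "(real ^ 'n::finite \<Rightarrow> complex) \<Rightarrow> complex" where
  "origin_lim h = Lim (at 0 within orthant) h"

lemma origin_lim_eqI: "(h \<longlongrightarrow> l) (at 0 within orthant) \<Longrightarrow> origin_lim h = l"
  unfolding origin_lim_def by (rule tendsto_Lim[OF at_0_within_orthant_neq_bot])

lemma tendsto_origin_lim: "T_regular h \<Longrightarrow> (h \<longlongrightarrow> origin_lim h) (at 0 within orthant)"
  using T_regular_limit[of h] origin_lim_eqI by metis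

lemma origin_lim_cong:
  assumes "\<And>x. x \<in> orthant \<Longrightarrow> f x = g x"
  shows "origin_lim f = origin_lim g"
  unfolding origin_lim_def by (rule Lim_cong) (use assms in \<open>simp_all add: eventually_at_filter\<close>)

text \<open>A substitute for Taylor's theorem, by descent from words of length M. If every T_i g is
  O(||x||^(2j)) and g tends to 0, then the partial derivatives x_i T_i g are O(||x||^(2j+1)), and a
  path towards the origin has length at most n ||x||, with n the dimension. Each step thus
  contributes the factor n ||x||^2.\<close>

lemma T_regular_decay:
  fixes h :: "real ^ 'n::finite \<Rightarrow> complex"
  assumes h: "T_regular h" and "B \<ge> 0"
    and B: "\<And>u x. length u = M \<Longrightarrow> x \<in> orthant \<Longrightarrow> norm x \<le> 1 \<Longrightarrow> norm (fold T_op u h x) \<le> B"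
    and lim: "\<And>u. length u < M \<Longrightarrow> origin_lim (fold T_op u h) = 0"
    and "length u + j = M" "x \<in> orthant" "norm x \<le> 1"
  shows "norm (fold T_op u h x) \<le> B * real CARD('n) ^ j * norm x ^ (2 * j)"
  using assms(5-7)
proof (induction j arbitrary: u x)
  case 0
  then show ?case using B by simp
next
  case (Suc j)
  define g where "g = fold T_op u h"
  have g: "T_regular g"
    unfolding g_def by (rule T_regular_fold_T_op[OF h])
  let ?C = "B * real CARD('n) ^ j * norm x ^ (2 * j)"
  \<comment> \<open>The origin is not in the orthant, so g is compared with its values at s x for 0
    < s < 1, with a bound independent of s.\<close>
  have bound: "norm (g x - g (s *\<^sub>R x)) \<le> B * real CARD('n) ^ Suc j * norm x ^ (2 * Suc j)"
    if s: "0 < s" "s < 1" for s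
  proof -
    have sx: "s *\<^sub>R x \<in> orthant"
      using Suc.prems s by (simp add: orthant_def)
    have "norm (g x - g (s *\<^sub>R x)) \<le> (\<Sum>i\<in>UNIV. \<bar>x $ i - (s *\<^sub>R x) $ i\<bar>) * (norm x * ?C)"
    proof (rule norm_diff_le_partial_derivs[OF T_regular_C_infinity[OF g] \<open>x \<in> orthant\<close> sx])
      fix y i assume y: "y \<in> orthant" "\<And>j. y $ j \<le> max (x $ j) ((s *\<^sub>R x) $ j)"
      have "y $ j \<le> x $ j" for j
        using y(2)[of j] s orthantD[OF \<open>x \<in> orthant\<close>, of j]
        by (smt (verit) mult_less_cancel_right2 vector_scaleR_component real_scaleR_def max_def)
      then have yx: "norm y \<le> norm x"
        by (rule norm_le_norm_orthant[OF y(1)])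
      have "norm (fold T_op (u @ [i]) h y) \<le> B * real CARD('n) ^ j * norm y ^ (2 * j)"
        using Suc.prems yx y by (intro Suc.IH) auto
      also have "\<dots> \<le> ?C"
        using yx \<open>B \<ge> 0\<close> by (intro mult_left_mono power_mono) auto
      finally have "norm (T_op i g y) \<le> ?C"
        by (simp add: g_def)
      moreover have "\<bar>y $ i\<bar> \<le> norm x"
        using component_le_norm_cart[of y i] yx by simp
      ultimately show "norm (partial_deriv i g y) \<le> norm x * ?C"
        using y by (simp only: partial_deriv_eq_T_op norm_mult norm_of_real) (intro mult_mono, auto)
    qed
    also have "\<dots> \<le> (\<Sum>i\<in>(UNIV::'n set). norm x) * (norm x * ?C)"
    proof (intro mult_right_mono sum_mono)
      fix i
      have "\<bar>x $ i - (s *\<^sub>R x) $ i\<bar> \<le> \<bar>x $ i\<bar>"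
        using s orthantD[OF \<open>x \<in> orthant\<close>, of i]
        by (simp add: abs_if mult_left_le_one_le)
      also have "\<dots> \<le> norm x"
        by (rule component_le_norm_cart)
      finally show "\<bar>x $ i - (s *\<^sub>R x) $ i\<bar> \<le> norm x" .
    qed (use \<open>B \<ge> 0\<close> in auto)
    finally show ?thesis
      by (simp add: algebra_simps power2_eq_square)
  qed
  \<comment> \<open>As s decreases to 0 the point s x reaches the origin from within the orthant,
    where g tends to 0: the word \<open>u\<close> is shorter than \<open>M\<close>, so
    \<open>lim\<close> applies to it.\<close>
  have "filterlim (\<lambda>s. s *\<^sub>R x) (at 0 within orthant) (at_right 0)"
    unfolding filterlim_at
  proof
    show "((\<lambda>s. s *\<^sub>R x) \<longlongrightarrow> 0) (at_right 0)"
      by (rule tendsto_eq_intros refl)+ simp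
    show "\<forall>\<^sub>F s in at_right 0. s *\<^sub>R x \<in> orthant \<and> s *\<^sub>R x \<noteq> 0"
      using eventually_at_right_less[of 0]
    proof eventually_elim
      case (elim s)
      then have "s *\<^sub>R x \<in> orthant"
        using \<open>x \<in> orthant\<close> by (simp add: orthant_def)
      then show ?case by (auto simp: orthant_def)
    qed
  qed
  moreover have "(g \<longlongrightarrow> 0) (at 0 within orthant)"
    using tendsto_origin_lim[OF g] lim[of u] Suc.prems by (simp add: g_def)
  ultimately have "((\<lambda>s. g (s *\<^sub>R x)) \<longlongrightarrow> 0) (at_right 0)"
    by (rule filterlim_compose[rotated])
  then have "((\<lambda>s. norm (g x - g (s *\<^sub>R x))) \<longlongrightarrow> norm (g x - 0)) (at_right 0)"
    by (intro tendsto_intros)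
  moreover have "\<forall>\<^sub>F s in at_right 0. norm (g x - g (s *\<^sub>R x)) \<le> B * real CARD('n) ^ Suc j * norm x ^ (2 * Suc j)"
    using bound by (auto simp: eventually_at_right_field intro!: exI[of _ 1])
  ultimately have "norm (g x - 0) \<le> B * real CARD('n) ^ Suc j * norm x ^ (2 * Suc j)"
    by (rule tendsto_upperbound) simp
  then show ?case by (simp add: g_def)
qed

section \<open>The operators \<open>S\<^sub>i\<close> in weighted form\<close>

text \<open>For \<open>c = 2\<mu>\<^sub>i + 2\<close> this is \<open>S\<^sub>i\<close> conjugated with \<open>x\<^bsup>-\<mu>-1/2\<^esup>\<close>. The parameter is
  free because commuting with \<open>T\<^sub>i\<close> raises it by 2.\<close>

definition bessel_op :: "real \<Rightarrow> 'n::finite \<Rightarrow> (real ^ 'n \<Rightarrow> complex) \<Rightarrow> real ^ 'n \<Rightarrow> complex" where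
  "bessel_op c i h x = of_real c * T_op i h x + of_real ((x $ i)\<^sup>2) * T_op i (T_op i h) x"

lemma C_infinity_on_coord_sq: "C_infinity_on orthant (\<lambda>x. complex_of_real ((x $ i)\<^sup>2))"
  unfolding power2_eq_square of_real_mult
  by (intro C_infinity_on_mult C_infinity_on_coord open_orthant)

lemma C_infinity_on_bessel_op:
  assumes "C_infinity_on orthant h"
  shows "C_infinity_on orthant (bessel_op c i h)"
  unfolding bessel_op_def[abs_def]
  by (intro C_infinity_on_add C_infinity_on_mult C_infinity_on_const C_infinity_on_coord_sq
      C_infinity_on_T_op open_orthant assms)

lemma bessel_op_cong:
  assumes "x \<in> orthant" "\<And>y. y \<in> orthant \<Longrightarrow> f y = g y"
  shows "bessel_op c i f x = bessel_op c i g x"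
proof -
  have "T_op i f y = T_op i g y" if "y \<in> orthant" for y
    using that assms(2) by (rule T_op_cong)
  then show ?thesis
    using T_op_cong[OF assms(1), of "T_op i f" "T_op i g" i] assms(1) by (simp add: bessel_op_def)
qed

text \<open>The only variable coefficient is x_i^2, and T_i sends it to 2. The extra term 2 T_i (T_i
  h) merges with the first-order part.\<close>

lemma T_op_bessel_op:
  assumes h: "C_infinity_on orthant h" and x: "x \<in> orthant"
  shows "T_op j (bessel_op c i h) x = bessel_op (if j = i then c + 2 else c) i (T_op j h) x"
proof -
  have "T_op j (bessel_op c i h) x =
      of_real c * T_op j (T_op i h) x +
      ((if j = i then 2 else 0) * T_op i (T_op i h) x + of_real ((x $ i)\<^sup>2) * T_op j (T_op i (T_op i h)) x)"
    unfolding bessel_op_def[abs_def]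
    by (simp only: T_op_add T_op_mult T_op_coord_sq T_op_const C_infinity_on_add C_infinity_on_mult
      C_infinity_on_const C_infinity_on_coord_sq C_infinity_on_T_op open_orthant h x mult_zero_left add_0)
  moreover have "T_op j (T_op i h) x = T_op i (T_op j h) x"
    using h x by (rule T_op_commute)
  moreover have "T_op j (T_op i (T_op i h)) x = T_op i (T_op i (T_op j h)) x"
    using T_op_fold_commute[OF h x, of j "[i, i]"] by simp
  ultimately show ?thesis
    by (auto simp: bessel_op_def algebra_simps)
qed

lemma fold_T_op_bessel_op:
  assumes "C_infinity_on orthant h" and x: "x \<in> orthant"
  shows "fold T_op u (bessel_op c i h) x = bessel_op (c + 2 * count_list u i) i (fold T_op u h) x"
  using assms(1)
proof (induction u arbitrary: c h)
  case (Cons j u)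
  have "fold T_op u (T_op j (bessel_op c i h)) x =
      fold T_op u (bessel_op (if j = i then c + 2 else c) i (T_op j h)) x"
    by (rule fold_T_op_cong[OF _ x]) (simp only: T_op_bessel_op Cons.prems)
  with Cons show ?case
    by (simp add: C_infinity_on_T_op algebra_simps)
qed simp

lemma T_regular_bessel_op:
  assumes h: "T_regular h"
  shows "T_regular (bessel_op c i h)"
  unfolding T_regular_def
proof (intro conjI allI)
  show "C_infinity_on orthant (bessel_op c i h)"
    by (intro C_infinity_on_bessel_op T_regular_C_infinity h)
  fix u :: "'a list"
  obtain B where B: "B \<ge> 0" "\<And>v x. length v \<le> length u + 2 \<Longrightarrow> x \<in> orthant \<Longrightarrow> norm x \<le> 1 \<Longrightarrow>
      norm (fold T_op v h x) \<le> B"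
    using T_regularD[OF h, of "length u + 2"] by metis
  define d where "d = c + 2 * count_list u i"
  have "norm (fold T_op u (bessel_op c i h) x) \<le> \<bar>d\<bar> * B + 1 * B" if "x \<in> orthant" "norm x \<le> 1" for x
  proof -
    have "norm (T_op i (fold T_op u h) x) \<le> B" "norm (T_op i (T_op i (fold T_op u h)) x) \<le> B"
      using B(2)[of "u @ [i]" x] B(2)[of "u @ [i, i]" x] that by simp_all
    moreover have "\<bar>x $ i\<bar> \<le> 1"
      using component_le_norm_cart[of x i] that by simp
    then have "(x $ i)\<^sup>2 \<le> 1"
      by (simp add: abs_square_le_1)
    moreover have "fold T_op u (bessel_op c i h) x = bessel_op d i (fold T_op u h) x"
      unfolding d_def by (rule fold_T_op_bessel_op[OF T_regular_C_infinity[OF h] that(1)])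
    moreover have "norm (bessel_op d i (fold T_op u h) x) \<le>
        \<bar>d\<bar> * norm (T_op i (fold T_op u h) x) + (x $ i)\<^sup>2 * norm (T_op i (T_op i (fold T_op u h)) x)"
      unfolding bessel_op_def by (rule order_trans[OF norm_triangle_ineq]) (simp add: norm_mult norm_power)
    moreover have "\<dots> \<le> \<bar>d\<bar> * B + 1 * B"
      using calculation(1-3) B(1) by (intro add_mono mult_mono) auto
    ultimately show ?thesis by simp
  qed
  then show "\<exists>B. \<forall>x\<in>orthant. norm x \<le> 1 \<longrightarrow> norm (fold T_op u (bessel_op c i h) x) \<le> B"
    by blast
qed

lemma origin_lim_bessel_op:
  assumes h: "T_regular h"
  shows "origin_lim (bessel_op c i h) = of_real c * origin_lim (T_op i h)"
proof (rule origin_lim_eqI)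
  have "((\<lambda>x. of_real c * T_op i h x + of_real ((x $ i)\<^sup>2) * T_op i (T_op i h) x) \<longlongrightarrow>
      of_real c * origin_lim (T_op i h) + of_real (((0::real^'a) $ i)\<^sup>2) * origin_lim (T_op i (T_op i h)))
      (at 0 within orthant)"
    by (intro tendsto_intros tendsto_origin_lim T_regular_T_op h)
  then show "(bessel_op c i h \<longlongrightarrow> of_real c * origin_lim (T_op i h)) (at 0 within orthant)"
    by (simp add: bessel_op_def[abs_def])
qed

lemma T_regular_foldr_bessel_op:
  "T_regular h \<Longrightarrow> T_regular (foldr (\<lambda>i. bessel_op (c i) i) v h)"
  by (induction v) (auto intro: T_regular_bessel_op)

text \<open>Only the first-order term of \<open>bessel_op\<close> survives at the origin, and it has a positive
  coefficient.\<close>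

lemma origin_lim_foldr_bessel_op:
  assumes c: "\<And>i. c i > 0"
  shows "\<exists>\<kappa>>0. \<forall>h. T_regular h \<longrightarrow> origin_lim (fold T_op u (foldr (\<lambda>i. bessel_op (c i) i) v h)) =
    of_real \<kappa> * origin_lim (fold T_op (u @ v) h)"
proof (induction v arbitrary: u)
  case Nil
  show ?case by (auto intro!: exI[of _ 1])
next
  case (Cons i v)
  \<comment> \<open>The first-order coefficient after \<open>bessel_op\<close> has been moved past
    the word \<open>u\<close>: every letter \<open>i\<close> of \<open>u\<close> adds 2, so it
    remains positive.\<close>
  define d where "d = c i + 2 * count_list u i"
  have "d > 0" using c[of i] by (simp add: d_def add_pos_nonneg)
  \<comment> \<open>The surviving T_i joins the outer word, which is why the induction keeps
    \<open>u\<close> arbitrary.\<close>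
  obtain \<kappa> where \<kappa>: "\<kappa> > 0" "\<And>h. T_regular h \<Longrightarrow>
      origin_lim (fold T_op (u @ [i]) (foldr (\<lambda>i. bessel_op (c i) i) v h)) =
      of_real \<kappa> * origin_lim (fold T_op ((u @ [i]) @ v) h)"
    using Cons.IH[of "u @ [i]"] by blast
  have "origin_lim (fold T_op u (foldr (\<lambda>i. bessel_op (c i) i) (i # v) h)) =
    of_real (d * \<kappa>) * origin_lim (fold T_op (u @ i # v) h)" if h: "T_regular h" for h
  proof -
    define g where "g = foldr (\<lambda>i. bessel_op (c i) i) v h"
    have g: "T_regular g"
      unfolding g_def by (rule T_regular_foldr_bessel_op[OF h])
    have "origin_lim (fold T_op u (bessel_op (c i) i g)) = origin_lim (bessel_op d i (fold T_op u g))"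
      unfolding d_def by (intro origin_lim_cong fold_T_op_bessel_op T_regular_C_infinity g)
    also have "\<dots> = of_real d * origin_lim (T_op i (fold T_op u g))"
      by (intro origin_lim_bessel_op T_regular_fold_T_op g)
    finally show ?thesis
      using \<kappa>(2)[OF h] by (simp add: g_def)
  qed
  then show ?case
    using \<open>d > 0\<close> \<kappa>(1) by (intro exI[of _ "d * \<kappa>"]) simp
qed

section \<open>Conjugating S_i with the weight\<close>

lemma partial_deriv_vec_powr_mult:
  assumes "C_infinity_on orthant h" "x \<in> orthant"
  shows "partial_deriv i (\<lambda>x. complex_of_real (vec_powr x b) * h x) x =
    of_real (vec_powr x b) * (of_real (b $ i / x $ i) * h x + partial_deriv i h x)"
proof -
  have "partial_deriv i (\<lambda>x. complex_of_real (vec_powr x b)) x = of_real (vec_powr x b * (b $ i / x $ i))"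
  proof (rule partial_derivI)
    have "((\<lambda>t. vec_powr (x + t *\<^sub>R axis i 1) b) has_real_derivative
        (\<Sum>j\<in>UNIV. (if j = i then b $ j * x $ j powr (b $ j - 1) else 0) *
          (\<Prod>k\<in>UNIV - {j}. x $ k powr b $ k))) (at 0)"
    proof -
      have "((\<lambda>t. (x + t *\<^sub>R axis i 1) $ j powr b $ j) has_real_derivative
          (if j = i then b $ j * x $ j powr (b $ j - 1) else 0)) (at 0)" for j
        using orthantD[OF assms(2), of j] by (auto intro!: derivative_eq_intros simp: axis_def)
      then show ?thesis
        using has_field_derivative_prod[of UNIV "\<lambda>j t. (x + t *\<^sub>R axis i 1) $ j powr b $ j"
            "\<lambda>j. if j = i then b $ j * x $ j powr (b $ j - 1) else 0" 0]
        unfolding vec_powr_def by simp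
    qed
    also have "(\<Sum>j\<in>UNIV. (if j = i then b $ j * x $ j powr (b $ j - 1) else 0) *
          (\<Prod>k\<in>UNIV - {j}. x $ k powr b $ k)) =
        b $ i * x $ i powr (b $ i - 1) * (\<Prod>k\<in>UNIV - {i}. x $ k powr b $ k)"
      by (subst sum.remove[of UNIV i]) (auto intro!: sum.neutral)
    also have "\<dots> = vec_powr x b * (b $ i / x $ i)"
      using orthantD[OF assms(2), of i]
      by (simp add: vec_powr_def prod.remove[of UNIV i] powr_diff field_simps)
    finally show "((\<lambda>t. complex_of_real (vec_powr (x + t *\<^sub>R axis i 1) b)) has_vector_derivative
        of_real (vec_powr x b * (b $ i / x $ i))) (at 0)"
      by (intro has_vector_derivative_of_real) (simp add: has_real_derivative_iff_has_vector_derivative)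
  qed
  moreover have "T_op i (\<lambda>x. complex_of_real (vec_powr x b) * h x) x =
      T_op i (\<lambda>x. complex_of_real (vec_powr x b)) x * h x + of_real (vec_powr x b) * T_op i h x"
    by (intro T_op_mult C_infinity_on_vec_powr assms)
  ultimately show ?thesis
    using orthantD[OF assms(2), of i] by (simp add: T_op_def scaleR_conv_of_real field_simps)
qed

lemma C_infinity_on_S_op:
  fixes \<mu> :: "real ^ 'n::finite"
  assumes "C_infinity_on orthant \<phi>"
  shows "C_infinity_on orthant (S_op \<mu> i \<phi>)"
proof (rule C_infinity_on_cong[OF open_orthant])
  let ?c = "- ((4 * (\<mu> $ i)\<^sup>2 - 1) / 4)"
  show "C_infinity_on orthant (\<lambda>x. partial_deriv i (partial_deriv i \<phi>) x +
      of_real ?c * (complex_of_real (x $ i powr (-2)) * \<phi> x))"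
    by (intro C_infinity_on_add C_infinity_on_mult C_infinity_on_const C_infinity_on_coord_powr
        C_infinity_on_partial_deriv open_orthant assms)
  fix y :: "real ^ 'n" assume y: "y \<in> orthant"
  have "y $ i powr (-2) = inverse ((y $ i)\<^sup>2)"
    using orthantD[OF y, of i] by (simp add: powr_minus)
  then have "?c * y $ i powr (-2) = - ((4 * (\<mu> $ i)\<^sup>2 - 1) / (4 * (y $ i)\<^sup>2))"
    by (simp add: divide_simps)
  then have "complex_of_real ?c * complex_of_real (y $ i powr (-2)) =
      - of_real ((4 * (\<mu> $ i)\<^sup>2 - 1) / (4 * (y $ i)\<^sup>2))"
    by (metis of_real_minus of_real_mult)
  then show "partial_deriv i (partial_deriv i \<phi>) y +
      of_real ?c * (complex_of_real (y $ i powr (-2)) * \<phi> y) = S_op \<mu> i \<phi> y"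
    using y by (simp only: S_op_def scaleR_conv_of_real mult.assoc[symmetric] if_True mult_minus_left
        mult_minus_right add_uminus_conv_diff)
qed

lemma vec_powr_pos: "x \<in> orthant \<Longrightarrow> vec_powr x a > 0"
  unfolding vec_powr_def using orthantD_neq by (intro prod_pos) auto

lemma weighted_inverse:
  assumes "x \<in> orthant"
  shows "\<phi> x = of_real (vec_powr x (\<chi> i. \<mu> $ i + 1/2)) * weighted \<mu> \<phi> x"
proof -
  have "vec_powr x (\<chi> i. \<mu> $ i + 1/2) * vec_powr x (\<chi> i. - \<mu> $ i - 1/2) = 1"
    using orthantD_neq[OF assms]
    by (simp add: vec_powr_def flip: prod.distrib powr_add)
  then show ?thesis
    by (simp add: weighted_def scaleR_conv_of_real flip: mult.assoc of_real_mult)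
qed

text \<open>With \<phi> = x^b w and b = \<mu> + 1/2, two derivatives in x_i produce the zero-order
  term b_i (b_i - 1) / x_i^2. Since b_i (b_i - 1) = \<mu>_i^2 - 1/4, it cancels the potential of
  S_i. The remainder is the second derivative of w plus (2\<mu>_i + 1)/x_i times the first.
  Substituting x_i T_i for the derivative gives the Bessel form, the additional T_i coming from the
  derivative of x_i.\<close>

lemma weighted_S_op:
  assumes \<phi>: "C_infinity_on orthant \<phi>" and x: "x \<in> orthant"
  shows "weighted \<mu> (S_op \<mu> i \<phi>) x = bessel_op (2 * \<mu> $ i + 2) i (weighted \<mu> \<phi>) x"
proof -
  define w where "w = weighted \<mu> \<phi>"
  have w: "C_infinity_on orthant w"
    unfolding w_def by (rule C_infinity_on_weighted[OF \<phi>])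
  define b where "b = (\<chi> i. \<mu> $ i + 1/2)"
  define V where "V y = complex_of_real (vec_powr y b)" for y
  define m where "m = \<mu> $ i"
  have b: "b $ i = m + 1/2" by (simp add: b_def m_def)
  \<comment> \<open>\<open>H\<close> is the i-derivative of \<phi> stripped of the weight
    \<open>V\<close>, so the same product formula can be applied a second time. Writing 1/x_i as a
    power gives its smoothness.\<close>
  define H where "H y = of_real (b $ i) * (of_real (y $ i powr (-1)) * w y) + partial_deriv i w y" for y
  have H: "C_infinity_on orthant H"
    unfolding H_def by (intro C_infinity_on_add C_infinity_on_mult C_infinity_on_const
        C_infinity_on_coord_powr C_infinity_on_partial_deriv open_orthant w)
  have phi: "\<phi> y = V y * w y" if "y \<in> orthant" for y
    unfolding V_def w_def b_def by (rule weighted_inverse[OF that])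
  have d1: "partial_deriv i \<phi> y = V y * H y" if y: "y \<in> orthant" for y
  proof -
    have "partial_deriv i \<phi> y = partial_deriv i (\<lambda>y. V y * w y) y"
      by (rule partial_deriv_cong[OF open_orthant y phi])
    also have "\<dots> = V y * (of_real (b $ i / y $ i) * w y + partial_deriv i w y)"
      unfolding V_def by (rule partial_deriv_vec_powr_mult[OF w y])
    also have "\<dots> = V y * H y"
      using orthantD[OF y, of i] by (simp add: H_def powr_minus divide_inverse)
    finally show ?thesis .
  qed
  have d2: "partial_deriv i (partial_deriv i \<phi>) x = V x * (of_real (b $ i / x $ i) * H x + partial_deriv i H x)"
  proof -
    have "partial_deriv i (partial_deriv i \<phi>) x = partial_deriv i (\<lambda>y. V y * H y) x"
      by (rule partial_deriv_cong[OF open_orthant x d1])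
    then show ?thesis
      unfolding V_def by (simp add: partial_deriv_vec_powr_mult[OF H x])
  qed
  define q where "q = complex_of_real (x $ i)"
  define A where "A = T_op i w x"
  define B where "B = T_op i (T_op i w) x"
  have q: "q \<noteq> 0"
    using orthantD[OF x, of i] by (simp add: q_def)
  have "T_op i (partial_deriv i w) x = T_op i (\<lambda>y. of_real (y $ i powr 1) * T_op i w y) x"
    by (rule T_op_cong[OF x]) (simp add: partial_deriv_eq_T_op orthantD_abs)
  also have "\<dots> = of_real (1 * x $ i powr (1 - 2)) * T_op i w x + of_real (x $ i powr 1) * T_op i (T_op i w) x"
    using T_op_mult[OF C_infinity_on_coord_powr[of i 1] C_infinity_on_T_op[OF w, of i] x, of i]
      T_op_coord_powr[OF x, of i i 1] by (simp only: refl if_True)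
  finally have Tw: "T_op i (partial_deriv i w) x = A / q + q * B"
    using orthantD[OF x, of i] by (simp add: powr_minus divide_inverse A_def B_def q_def)
  have "T_op i (\<lambda>y. of_real (y $ i powr (-1)) * w y) x =
      of_real (-1 * x $ i powr (-1 - 2)) * w x + of_real (x $ i powr (-1)) * A"
    using T_op_mult[OF C_infinity_on_coord_powr[of i "-1"] w x, of i]
      T_op_coord_powr[OF x, of i i "-1"] unfolding A_def by (simp only: refl if_True)
  moreover have "x $ i powr (-1 - 2) = inverse (x $ i ^ 3)"
    using orthantD[OF x, of i] by (simp add: powr_minus)
  ultimately have Tw': "T_op i (\<lambda>y. of_real (y $ i powr (-1)) * w y) x = - w x / q ^ 3 + A / q"
    using orthantD[OF x, of i] by (simp add: powr_minus divide_inverse q_def mult.commute)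
  have "T_op i (\<lambda>y. of_real (b $ i) * (of_real (y $ i powr (-1)) * w y)) x =
      of_real (b $ i) * T_op i (\<lambda>y. of_real (y $ i powr (-1)) * w y) x"
    using fold_T_op_cmult[OF C_infinity_on_mult[OF open_orthant C_infinity_on_coord_powr[of i "-1"] w] x, of "[i]"]
    by simp
  then have "T_op i H x = of_real (b $ i) * (- w x / q ^ 3 + A / q) + (A / q + q * B)"
    unfolding H_def
    using T_op_add[OF C_infinity_on_mult[OF open_orthant C_infinity_on_const[of orthant "of_real (b $ i)"]
        C_infinity_on_mult[OF open_orthant C_infinity_on_coord_powr[of i "-1"] w]]
        C_infinity_on_partial_deriv[OF w, of i] x, of i]
    by (simp only: Tw Tw')
  then have dH: "partial_deriv i H x = of_real (b $ i) * (- w x / q ^ 2 + A) + (A + q ^ 2 * B)"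
    using q by (simp add: partial_deriv_eq_T_op[OF x] flip: q_def)
      (simp add: field_simps power2_eq_square power3_eq_cube)
  have Hx: "H x = of_real (b $ i) * (w x / q) + q * A"
    using orthantD[OF x, of i]
    by (simp add: H_def q_def A_def partial_deriv_eq_T_op[OF x] powr_minus divide_inverse mult.commute)
  have "S_op \<mu> i \<phi> x = V x * (of_real (b $ i / x $ i) * H x + partial_deriv i H x)
      - of_real ((4 * m\<^sup>2 - 1) / (4 * (x $ i)\<^sup>2)) * (V x * w x)"
    using x by (simp add: S_op_def d2 phi scaleR_conv_of_real m_def)
  \<comment> \<open>Here the terms in \<open>w x / q ^ 2\<close> cancel, by (m + 1/2)(m - 1/2) = m^2
    - 1/4.\<close>
  also have "\<dots> = V x * (of_real (2 * m + 2) * A + q ^ 2 * B)"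
    using q unfolding Hx dH b of_real_divide of_real_power of_real_mult of_real_diff of_real_add q_def[symmetric]
    by (simp add: field_simps power2_eq_square)
  finally have S: "S_op \<mu> i \<phi> x = V x * (of_real (2 * m + 2) * A + q ^ 2 * B)" .
  have "V x * weighted \<mu> (S_op \<mu> i \<phi>) x = V x * (of_real (2 * m + 2) * A + q ^ 2 * B)"
    unfolding S[symmetric] unfolding V_def b_def by (rule weighted_inverse[OF x, symmetric])
  moreover have "V x \<noteq> 0"
    using vec_powr_pos[OF x, of b] by (simp add: V_def)
  ultimately show ?thesis
    by (simp add: bessel_op_def m_def A_def B_def q_def w_def)
qed

lemma C_infinity_on_foldr_S_op:
  "C_infinity_on orthant \<phi> \<Longrightarrow> C_infinity_on orthant (foldr (S_op \<mu>) v \<phi>)"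
  by (induction v) (auto intro: C_infinity_on_S_op)

lemma weighted_foldr_S_op:
  assumes "C_infinity_on orthant \<phi>" "x \<in> orthant"
  shows "weighted \<mu> (foldr (S_op \<mu>) v \<phi>) x =
    foldr (\<lambda>i. bessel_op (2 * \<mu> $ i + 2) i) v (weighted \<mu> \<phi>) x"
  using assms(2)
proof (induction v arbitrary: x)
  case (Cons i v)
  have "weighted \<mu> (foldr (S_op \<mu>) (i # v) \<phi>) x =
      bessel_op (2 * \<mu> $ i + 2) i (weighted \<mu> (foldr (S_op \<mu>) v \<phi>)) x"
    using Cons.prems assms(1) by (simp add: weighted_S_op C_infinity_on_foldr_S_op)
  also have "\<dots> = bessel_op (2 * \<mu> $ i + 2) i (foldr (\<lambda>i. bessel_op (2 * \<mu> $ i + 2) i) v (weighted \<mu> \<phi>)) x"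
    by (rule bessel_op_cong[OF Cons.prems Cons.IH])
  finally show ?case by simp
qed simp

section \<open>Smooth cutoff functions\<close>

text \<open>Derivatives are existential witnesses, so closure under sums, products and composition
  follows by induction. Order 0 is empty; continuity comes from differentiability at order
  1.\<close>

primrec real_C_k :: "nat \<Rightarrow> (real \<Rightarrow> real) \<Rightarrow> bool" where
  "real_C_k 0 f \<longleftrightarrow> True"
| "real_C_k (Suc m) f \<longleftrightarrow> (\<exists>f'. (\<forall>t. (f has_real_derivative f' t) (at t)) \<and> real_C_k m f')"

lemma real_C_k_SucI:
  "(\<And>t. (f has_real_derivative f' t) (at t)) \<Longrightarrow> real_C_k m f' \<Longrightarrow> real_C_k (Suc m) f"
  by auto

lemma real_C_k_SucD: "real_C_k (Suc m) f \<Longrightarrow> real_C_k m f"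
proof (induction m arbitrary: f)
  case (Suc m)
  then obtain f' where "\<forall>t. (f has_real_derivative f' t) (at t)" "real_C_k (Suc m) f'"
    by (metis real_C_k.simps(2))
  with Suc.IH show ?case
    unfolding real_C_k.simps(2)[of m f] by blast
qed simp

lemma real_C_k_const: "real_C_k m (\<lambda>t. c)"
proof (induction m arbitrary: c)
  case (Suc m)
  then show ?case
    by (auto intro!: exI[of _ "\<lambda>t. 0"])
qed simp

lemma real_C_k_add: "real_C_k m f \<Longrightarrow> real_C_k m g \<Longrightarrow> real_C_k m (\<lambda>t. f t + g t)"
proof (induction m arbitrary: f g)
  case (Suc m)
  then obtain f' g' where "\<forall>t. (f has_real_derivative f' t) (at t)" "real_C_k m f'"
     "\<forall>t. (g has_real_derivative g' t) (at t)" "real_C_k m g'"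
    unfolding real_C_k.simps by blast
  with Suc.IH show ?case
    unfolding real_C_k.simps by (intro exI[of _ "\<lambda>t. f' t + g' t"]) (auto intro: DERIV_add)
qed simp

lemma real_C_k_mult: "real_C_k m f \<Longrightarrow> real_C_k m g \<Longrightarrow> real_C_k m (\<lambda>t. f t * g t)"
proof (induction m arbitrary: f g)
  case (Suc m)
  then obtain f' g' where fg: "\<forall>t. (f has_real_derivative f' t) (at t)" "real_C_k m f'"
     "\<forall>t. (g has_real_derivative g' t) (at t)" "real_C_k m g'"
    unfolding real_C_k.simps by blast
  have "real_C_k m (\<lambda>t. f' t * g t + g' t * f t)"
    using fg Suc.prems[THEN real_C_k_SucD] by (intro real_C_k_add Suc.IH)
  moreover have "\<And>t. ((\<lambda>t. f t * g t) has_real_derivative f' t * g t + g' t * f t) (at t)"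
    by (rule DERIV_mult[OF fg(1)[rule_format] fg(3)[rule_format]])
  ultimately show ?case
    by (rule real_C_k_SucI[rotated])
qed simp

lemma real_C_k_compose: "real_C_k m f \<Longrightarrow> real_C_k m g \<Longrightarrow> real_C_k m (\<lambda>t. f (g t))"
proof (induction m arbitrary: f g)
  case (Suc m)
  then obtain f' g' where fg: "\<forall>t. (f has_real_derivative f' t) (at t)" "real_C_k m f'"
     "\<forall>t. (g has_real_derivative g' t) (at t)" "real_C_k m g'"
    unfolding real_C_k.simps by blast
  have "real_C_k m (\<lambda>t. f' (g t) * g' t)"
    by (rule real_C_k_mult[OF Suc.IH[OF fg(2) Suc.prems(2)[THEN real_C_k_SucD]] fg(4)])
  moreover have "\<And>t. ((\<lambda>t. f (g t)) has_real_derivative f' (g t) * g' t) (at t)"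
    by (rule DERIV_chain2[OF fg(1)[rule_format] fg(3)[rule_format]])
  ultimately show ?case
    by (rule real_C_k_SucI[rotated])
qed simp

lemma real_C_infinity_derivatives:
  assumes "\<And>m. real_C_k m f"
  obtains D where "D 0 = f" "\<And>j t. (D j has_real_derivative D (Suc j) t) (at t)"
proof
  have step: "(g has_real_derivative deriv g t) (at t) \<and> real_C_k m (deriv g)"
    if g: "\<And>m. real_C_k m g" for g m t
  proof -
    obtain g' where g': "\<And>t. (g has_real_derivative g' t) (at t)" "real_C_k m g'"
      using g[of "Suc m"] by auto
    then have "deriv g = g'"
      by (auto intro: DERIV_imp_deriv)
    with g' show ?thesis by simp
  qed
  have smooth: "real_C_k m ((deriv ^^ j) f)" for j m
  proof (induction j arbitrary: m)
    case (Suc j)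
    then show ?case using step by simp
  qed (simp add: assms)
  show "((deriv ^^ j) f has_real_derivative (deriv ^^ Suc j) f t) (at t)" for j t
    using step[OF smooth] by simp
qed simp

text \<open>The classical flat function exp(-1/t), extended by 0, is the case n = 0. The powers of
  1/t are included because differentiation then stays within linear combinations of the
  family.\<close>

definition flat_exp :: "nat \<Rightarrow> real \<Rightarrow> real" where
  "flat_exp n t = (if t > 0 then exp (- inverse t) * inverse t ^ n else 0)"

lemma flat_exp_tendsto_0: "flat_exp n \<midarrow>0\<rightarrow> 0"
proof -
  have "((\<lambda>s. s ^ n / exp s) \<longlongrightarrow> (0::real)) at_top"
    by (rule tendsto_power_div_exp_0)
  then have "((\<lambda>t. inverse t ^ n / exp (inverse t)) \<longlongrightarrow> (0::real)) (at_right 0)"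
    by (rule filterlim_compose[OF _ filterlim_inverse_at_top_right])
  then have "(flat_exp n \<longlongrightarrow> 0) (at_right 0)"
    by (rule Lim_transform_eventually)
      (auto simp: eventually_at_filter flat_exp_def exp_minus field_simps)
  moreover have "(flat_exp n \<longlongrightarrow> 0) (at_left 0)"
    by (rule tendsto_eventually) (auto simp: eventually_at_filter flat_exp_def)
  ultimately show ?thesis
    by (simp add: filterlim_at_split)
qed

lemma flat_exp_has_derivative:
  "(flat_exp n has_real_derivative flat_exp (n + 2) t - of_nat n * flat_exp (n + 1) t) (at t)"
proof -
  consider "t > 0" | "t < 0" | "t = 0" by linarith
  then show ?thesis
  proof cases
    case 1
    have "((\<lambda>t. exp (- inverse t) * inverse t ^ n) has_real_derivative
        flat_exp (n + 2) t - of_nat n * flat_exp (n + 1) t) (at t)"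
      using 1 by (cases n)
        (auto intro!: derivative_eq_intros simp: flat_exp_def power2_eq_square algebra_simps,
          metis One_nat_def power_eq_if)
    then show ?thesis
      by (rule has_field_derivative_transform_within_open[where S = "{0<..}"])
        (use 1 in \<open>auto simp: flat_exp_def\<close>)
  next
    case 2
    have "((\<lambda>t. 0) has_real_derivative flat_exp (n + 2) t - of_nat n * flat_exp (n + 1) t) (at t)"
      using 2 by (simp add: flat_exp_def)
    then show ?thesis
      by (rule has_field_derivative_transform_within_open[where S = "{..<0}"])
        (use 2 in \<open>auto simp: flat_exp_def\<close>)
  next
    case 3
    \<comment> \<open>At 0 the difference quotient is \<open>flat_exp (Suc n)\<close> itself, which
      tends to 0.\<close>
    have "(\<lambda>h. (flat_exp n (0 + h) - flat_exp n 0) / h) \<midarrow>0\<rightarrow> 0"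
      by (rule Lim_transform_eventually[OF flat_exp_tendsto_0[of "Suc n"]])
        (auto simp: eventually_at_filter flat_exp_def divide_inverse)
    then have "(flat_exp n has_real_derivative 0) (at 0)"
      unfolding DERIV_def .
    then show ?thesis
      using 3 by (simp add: flat_exp_def)
  qed
qed

lemma real_C_k_flat_exp: "real_C_k m (flat_exp n)"
proof (induction m arbitrary: n)
  case (Suc m)
  have "real_C_k m (\<lambda>t. flat_exp (n + 2) t + (- of_nat n) * flat_exp (n + 1) t)"
    by (intro real_C_k_add real_C_k_mult real_C_k_const Suc.IH)
  then show ?case
    using flat_exp_has_derivative[of n]
    by (auto intro!: exI[of _ "\<lambda>t. flat_exp (n + 2) t - of_nat n * flat_exp (n + 1) t"])
qed simp

lemma real_C_k_affine: "real_C_k m (\<lambda>t. a * t + c)"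
proof (cases m)
  case (Suc k)
  then show ?thesis
    by (auto intro!: exI[of _ "\<lambda>t. a"] derivative_eq_intros real_C_k_const)
qed simp

text \<open>The whole sequence of derivatives is carried along, since T_i turns a radial function
  with profile \<open>D j\<close> into one with profile \<open>D (Suc j)\<close>.\<close>

definition cutoff_derivs :: "(nat \<Rightarrow> real \<Rightarrow> real) \<Rightarrow> bool" where
  "cutoff_derivs D \<longleftrightarrow> (\<forall>j t. (D j has_real_derivative D (Suc j) t) (at t)) \<and>
     (\<forall>t\<le>1. D 0 t = 1) \<and> (\<forall>t\<ge>2. D 0 t = 0)"

lemma cutoff_derivs_exist: "\<exists>D. cutoff_derivs D"
proof -
  define E where "E = exp (- 1 :: real)"
  \<comment> \<open>With \<psi> = \<open>flat_exp 0\<close> and E = \<psi>(1), this is \<psi>(E -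
    \<psi>(t - 1)) / \<psi>(E). For t \<le> 1 the inner value is 0 and the quotient is 1; for t
    \<ge> 2 the inner value is at least E, so the outer argument is nonpositive.\<close>
  define f where "f t = flat_exp 0 (E + (-1) * flat_exp 0 (1 * t + (-1))) * inverse (flat_exp 0 E)" for t
  have smooth: "real_C_k m f" for m
    unfolding f_def[abs_def]
    by (intro real_C_k_mult real_C_k_const real_C_k_compose[OF real_C_k_flat_exp] real_C_k_add
        real_C_k_affine)
  have "flat_exp 0 E \<noteq> 0"
    by (simp add: flat_exp_def E_def)
  then have "f t = 1" if "t \<le> 1" for t
    using that by (simp add: f_def flat_exp_def[of 0 "t - 1"])
  moreover have "f t = 0" if "t \<ge> 2" for t
  proof -
    have "flat_exp 0 (t - 1) \<ge> E"
      using that by (simp add: flat_exp_def E_def inverse_le_1_iff)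
    then show ?thesis
      by (simp add: f_def flat_exp_def[of 0 "E - flat_exp 0 (t - 1)"])
  qed
  ultimately show ?thesis
    using real_C_infinity_derivatives[OF smooth] unfolding cutoff_derivs_def by metis
qed

lemma cutoff_derivsD:
  assumes "cutoff_derivs D"
  shows "(D j has_real_derivative D (Suc j) t) (at t)" "t \<le> 1 \<Longrightarrow> D 0 t = 1"
  using assms by (auto simp: cutoff_derivs_def)

text \<open>The strict inequality describes an open half-line, so vanishing there is inherited by
  every derivative.\<close>

lemma cutoff_derivs_eq_0:
  assumes "cutoff_derivs D" "t > 2"
  shows "D j t = 0"
  using assms(2)
proof (induction j arbitrary: t)
  case 0
  then show ?case using assms(1) by (simp add: cutoff_derivs_def)
next
  case (Suc j)
  have "((\<lambda>t. 0) has_real_derivative D (Suc j) t) (at t)"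
    using cutoff_derivsD(1)[OF assms(1)]
    by (rule has_field_derivative_transform_within_open[where S = "{2<..}"]) (use Suc in auto)
  then show ?case
    using DERIV_unique DERIV_const by blast
qed

lemma cutoff_derivs_bounded:
  assumes D: "cutoff_derivs D"
  obtains A where "A \<ge> 0" "\<And>j t. j \<le> K \<Longrightarrow> t \<ge> 0 \<Longrightarrow> \<bar>D j t\<bar> \<le> A"
proof -
  have "\<exists>b. \<forall>t\<ge>0. \<bar>D j t\<bar> \<le> b" for j
  proof -
    have "continuous_on {0..2} (D j)"
      using cutoff_derivsD(1)[OF D] by (meson DERIV_isCont continuous_at_imp_continuous_on)
    then have "bounded (D j ` {0..2})"
      by (intro compact_imp_bounded compact_continuous_image) auto
    then obtain b where b: "\<forall>t\<in>{0..2}. \<bar>D j t\<bar> \<le> b"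
      by (auto simp: bounded_iff)
    then have "0 \<le> b"
      by (meson abs_ge_zero atLeastAtMost_iff order_refl order_trans zero_le_numeral)
    then have "\<bar>D j t\<bar> \<le> b" if "t \<ge> 0" for t
      using b that cutoff_derivs_eq_0[OF D, of t j] by (cases "t > 2") auto
    then show ?thesis by blast
  qed
  then obtain b where b: "\<And>j t. t \<ge> 0 \<Longrightarrow> \<bar>D j t\<bar> \<le> b j"
    by metis
  show ?thesis
  proof (rule that[of "\<Sum>j\<le>K. \<bar>b j\<bar>"])
    show "\<bar>D j t\<bar> \<le> (\<Sum>j\<le>K. \<bar>b j\<bar>)" if "j \<le> K" "t \<ge> 0" for j t
    proof -
      have "\<bar>D j t\<bar> \<le> \<bar>b j\<bar>"
        using b[OF that(2), of j] by simp
      also have "\<dots> \<le> (\<Sum>j\<le>K. \<bar>b j\<bar>)"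
        using that by (intro member_le_sum) auto
      finally show ?thesis .
    qed
  qed (simp add: sum_nonneg)
qed

section \<open>Radial cutoffs and their products under words in T_i\<close>

definition radial :: "(real \<Rightarrow> real) \<Rightarrow> real \<Rightarrow> real ^ 'n::finite \<Rightarrow> complex" where
  "radial g q x = complex_of_real (g ((norm x)\<^sup>2 / q))"

lemma has_vector_derivative_radial:
  assumes D: "\<And>t. (g has_real_derivative g' t) (at t)"
  shows "((\<lambda>t. radial g q (x + t *\<^sub>R axis i 1)) has_vector_derivative
     of_real (2 / q) * (of_real (x $ i) * radial g' q x)) (at 0)"
proof -
  have eq: "(norm (x + t *\<^sub>R axis i 1))\<^sup>2 = (norm x)\<^sup>2 + 2 * x $ i * t + t * t" for t
    by (simp add: power2_norm_eq_inner inner_simps inner_axis inner_axis' inner_commute algebra_simps)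
  have "((\<lambda>t. ((norm x)\<^sup>2 + 2 * x $ i * t + t * t) / q) has_real_derivative 2 * x $ i / q) (at 0)"
    unfolding divide_inverse by (auto intro!: derivative_eq_intros)
  then have "((\<lambda>t. g (((norm x)\<^sup>2 + 2 * x $ i * t + t * t) / q)) has_real_derivative
      g' ((norm x)\<^sup>2 / q) * (2 * x $ i / q)) (at 0)"
    by (intro DERIV_chain2[of g]) (simp_all add: D)
  then have "((\<lambda>t. complex_of_real (g (((norm x)\<^sup>2 + 2 * x $ i * t + t * t) / q))) has_vector_derivative
      of_real (g' ((norm x)\<^sup>2 / q) * (2 * x $ i / q))) (at 0)"
    by (intro has_vector_derivative_of_real) (simp add: has_real_derivative_iff_has_vector_derivative)
  then show ?thesis
    by (simp add: radial_def eq mult_ac)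
qed

lemma C_infinity_on_radial:
  assumes D: "cutoff_derivs D" and U: "open U"
  shows "C_infinity_on U (radial (D j) q)"
proof -
  have "C_k_on m U (radial (D j) q)" for m
  proof (induction m arbitrary: j)
    case 0
    have "continuous_on UNIV (D j)"
      using cutoff_derivsD(1)[OF D] by (meson DERIV_isCont continuous_at_imp_continuous_on)
    then have "continuous_on U (\<lambda>x. D j ((norm x)\<^sup>2 / q))"
      unfolding divide_inverse
      by (rule continuous_on_compose2) (intro continuous_on_mult continuous_on_power continuous_on_norm
          continuous_on_id continuous_on_const, simp)
    then show ?case
      unfolding C_k_on.simps radial_def[abs_def] by (rule continuous_on_of_real)
  next
    case (Suc m)
    show ?case
    proof (rule C_k_on_SucI[OF U _ has_vector_derivative_radial[OF cutoff_derivsD(1)[OF D]]])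
      show "continuous_on U (radial (D j) q)"
        using Suc.IH[of j] by (cases m) auto
      show "C_k_on m U (\<lambda>x. of_real (2 / q) * (of_real (x $ i) * radial (D (Suc j)) q x))" for i
        by (intro C_k_on_mult U C_k_on_const C_k_on_coord Suc.IH)
    qed
  qed
  then show ?thesis
    by (simp add: C_infinity_on_def)
qed

text \<open>The factor x_i in the derivative of ||x||^2 cancels the 1/x_i of T_i, so the result is
  again radial.\<close>

lemma T_op_radial:
  assumes D: "cutoff_derivs D" and x: "x \<in> orthant"
  shows "T_op i (radial (D j) q) x = of_real (2 / q) * radial (D (Suc j)) q x"
  using T_op_eqI[OF has_vector_derivative_radial[OF cutoff_derivsD(1)[OF D, of j], where q = q and x = x and i = i]]
    orthantD[OF x, of i]
  by (simp add: scaleR_conv_of_real)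

text \<open>Applying the Leibniz rule to one letter only gives a recursion in which either
  \<open>f\<close> is differentiated or the index of \<open>D\<close> is raised. No sum over
  subwords appears.\<close>

lemma fold_T_op_mult_radial_step:
  fixes f :: "real ^ 'n::finite \<Rightarrow> complex"
  assumes f: "C_infinity_on orthant f" and D: "cutoff_derivs D" and x: "x \<in> orthant"
  shows "fold T_op (i # u) (\<lambda>x. f x * radial (D j) q x) x =
    fold T_op u (\<lambda>x. T_op i f x * radial (D j) q x) x +
    of_real (2 / q) * fold T_op u (\<lambda>x. f x * radial (D (Suc j)) q x) x"
proof -
  have "fold T_op u (T_op i (\<lambda>x. f x * radial (D j) q x)) x =
      fold T_op u (\<lambda>x. T_op i f x * radial (D j) q x +
        of_real (2 / q) * (f x * radial (D (Suc j)) q x)) x"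
  proof (rule fold_T_op_cong[OF _ x])
    fix y :: "real ^ 'n" assume y: "y \<in> orthant"
    show "T_op i (\<lambda>x. f x * radial (D j) q x) y = T_op i f y * radial (D j) q y +
        of_real (2 / q) * (f y * radial (D (Suc j)) q y)"
      using T_op_mult[OF f C_infinity_on_radial[OF D open_orthant] y] T_op_radial[OF D y]
      by simp
  qed
  also have "\<dots> = fold T_op u (\<lambda>x. T_op i f x * radial (D j) q x) x +
      fold T_op u (\<lambda>x. of_real (2 / q) * (f x * radial (D (Suc j)) q x)) x"
    by (intro fold_T_op_add C_infinity_on_mult C_infinity_on_const C_infinity_on_radial D
        C_infinity_on_T_op open_orthant f x)
  also have "fold T_op u (\<lambda>x. of_real (2 / q) * (f x * radial (D (Suc j)) q x)) x =
      of_real (2 / q) * fold T_op u (\<lambda>x. f x * radial (D (Suc j)) q x) x"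
    by (intro fold_T_op_cmult C_infinity_on_mult C_infinity_on_radial D open_orthant f x)
  finally show ?thesis by simp
qed

lemma fold_T_op_mult_radial_eq_0:
  assumes "C_infinity_on orthant f" and D: "cutoff_derivs D" and x: "x \<in> orthant"
    and "q > 0" "(norm x)\<^sup>2 > 2 * q"
  shows "fold T_op u (\<lambda>x. f x * radial (D j) q x) x = 0"
  using assms(1)
proof (induction u arbitrary: f j)
  case Nil
  have "D j ((norm x)\<^sup>2 / q) = 0"
    using assms by (intro cutoff_derivs_eq_0[OF D]) (simp add: field_simps)
  then show ?case by (simp add: radial_def)
next
  case (Cons i u)
  then show ?case
    by (subst fold_T_op_mult_radial_step[OF _ D x]) (simp_all add: C_infinity_on_T_op)
qed

text \<open>Each \<open>T\<^sub>i\<close> that hits the cutoff costs a factor \<open>2/q\<close>, which the hypothesis on \<open>f\<close> pays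
  for.\<close>

lemma fold_T_op_mult_radial_bound:
  assumes "C_infinity_on orthant f" and D: "cutoff_derivs D" and x: "x \<in> orthant" and q: "q > 0"
    and A: "A \<ge> 0" "\<And>j. j \<le> K \<Longrightarrow> \<bar>D j ((norm x)\<^sup>2 / q)\<bar> \<le> A"
    and "\<And>v. length v \<le> length u \<Longrightarrow> norm (fold T_op v f x) \<le> C / q ^ length v"
    and "j + length u \<le> K"
  shows "norm (fold T_op u (\<lambda>x. f x * radial (D j) q x) x) \<le> A * C * 3 ^ length u / q ^ length u"
  using assms(1,7,8)
proof (induction u arbitrary: f j C)
  case Nil
  then have "norm (f x) \<le> C" "\<bar>D j ((norm x)\<^sup>2 / q)\<bar> \<le> A"
    using A(2)[of j] Nil.prems(2)[of "[]"] by auto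
  then have "norm (f x) * \<bar>D j ((norm x)\<^sup>2 / q)\<bar> \<le> C * A"
    by (intro mult_mono) (auto intro: order_trans[OF norm_ge_zero])
  then show ?case
    by (simp add: radial_def norm_mult mult.commute)
next
  case (Cons i u)
  let ?R = "A * C * 3 ^ length u / q ^ length (i # u)"
  \<comment> \<open>The words available for T_i f are one letter shorter, so the induction
    hypothesis is used with \<open>C / q\<close> in place of \<open>C\<close>.\<close>
  have "norm (fold T_op u (\<lambda>x. T_op i f x * radial (D j) q x) x) \<le> A * (C / q) * 3 ^ length u / q ^ length u"
  proof (rule Cons.IH)
    show "norm (fold T_op v (T_op i f) x) \<le> C / q / q ^ length v" if "length v \<le> length u" for v
      using Cons.prems(2)[of "i # v"] that by simp
  qed (use Cons.prems in \<open>auto intro: C_infinity_on_T_op\<close>)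
  then have 1: "norm (fold T_op u (\<lambda>x. T_op i f x * radial (D j) q x) x) \<le> ?R"
    by (simp add: field_simps)
  have "norm (fold T_op u (\<lambda>x. f x * radial (D (Suc j)) q x) x) \<le> A * C * 3 ^ length u / q ^ length u"
    using Cons.prems by (intro Cons.IH) auto
  then have "2 / q * norm (fold T_op u (\<lambda>x. f x * radial (D (Suc j)) q x) x) \<le>
      2 / q * (A * C * 3 ^ length u / q ^ length u)"
    using q by (intro mult_left_mono) auto
  then have 2: "norm (of_real (2 / q) * fold T_op u (\<lambda>x. f x * radial (D (Suc j)) q x) x) \<le> 2 * ?R"
    using q by (simp add: norm_mult norm_divide field_simps)
  \<comment> \<open>One share from differentiating \<open>f\<close> and two from the factor 2/q:
    hence the base 3.\<close>
  have "norm (fold T_op (i # u) (\<lambda>x. f x * radial (D j) q x) x) \<le> ?R + 2 * ?R"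
    unfolding fold_T_op_mult_radial_step[OF Cons.prems(1) D x]
    by (rule norm_triangle_le) (rule add_mono[OF 1 2])
  then show ?case by (simp add: mult_ac)
qed

section \<open>The space \<open>\<H>\<^sub>\<mu>\<close> and its dual\<close>

lemma weighted_add: "weighted \<mu> (\<lambda>x. \<phi> x + \<psi> x) = (\<lambda>x. weighted \<mu> \<phi> x + weighted \<mu> \<psi> x)"
  by (simp add: weighted_def scaleR_add_right fun_eq_iff)

lemma weighted_cmult: "weighted \<mu> (\<lambda>x. c * \<phi> x) = (\<lambda>x. c * weighted \<mu> \<phi> x)"
  by (simp add: weighted_def fun_eq_iff)

lemma weighted_mult_right: "weighted \<mu> (\<lambda>x. \<phi> x * g x) = (\<lambda>x. weighted \<mu> \<phi> x * g x)"
  by (simp add: weighted_def fun_eq_iff)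

lemma le_Hmu_seminorm:
  "x \<in> orthant \<Longrightarrow>
    ennreal ((1 + (norm x)\<^sup>2) ^ m * norm (fold T_op (mi_word k) (weighted \<mu> \<phi>) x)) \<le> Hmu_seminorm \<mu> m k \<phi>"
  unfolding Hmu_seminorm_def T_pow_eq_fold by (rule SUP_upper2[of x]) simp_all

lemma Hmu_seminorm_le:
  assumes "\<And>x. x \<in> orthant \<Longrightarrow>
    ennreal ((1 + (norm x)\<^sup>2) ^ m * norm (fold T_op (mi_word k) (weighted \<mu> \<phi>) x)) \<le> B"
  shows "Hmu_seminorm \<mu> m k \<phi> \<le> B"
  unfolding Hmu_seminorm_def T_pow_eq_fold using assms by (intro SUP_least) simp

text \<open>Real bounds for arbitrary words replace extended-real suprema over multi-indices.
  Sorting a word brings it into the form occurring in a seminorm.\<close>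

lemma Hmu_iff:
  "\<phi> \<in> Hmu \<mu> \<longleftrightarrow> (\<forall>x. x \<notin> orthant \<longrightarrow> \<phi> x = 0) \<and> C_infinity_on orthant \<phi> \<and>
    (\<forall>m u. \<exists>B. \<forall>x\<in>orthant. (1 + (norm x)\<^sup>2) ^ m * norm (fold T_op u (weighted \<mu> \<phi>) x) \<le> B)"
  (is "_ \<longleftrightarrow> ?Z \<and> ?C \<and> ?R")
proof -
  have "(\<forall>m k. Hmu_seminorm \<mu> m k \<phi> < \<infinity>) \<longleftrightarrow> ?R" if C: ?C
  proof (intro iffI allI)
    fix m and u :: "'a list"
    assume fin: "\<forall>m k. Hmu_seminorm \<mu> m k \<phi> < \<infinity>"
    define k where "k = count (mset u)"
    have "(1 + (norm x)\<^sup>2) ^ m * norm (fold T_op u (weighted \<mu> \<phi>) x) \<le> enn2real (Hmu_seminorm \<mu> m k \<phi>)"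
      if x: "x \<in> orthant" for x
    proof -
      have "fold T_op u (weighted \<mu> \<phi>) x = fold T_op (mi_word k) (weighted \<mu> \<phi>) x"
        by (rule fold_T_op_perm) (simp_all add: k_def mset_mi_word_count C_infinity_on_weighted C x)
      moreover have "Hmu_seminorm \<mu> m k \<phi> < \<infinity>"
        using fin by blast
      ultimately show ?thesis
        using enn2real_mono[OF le_Hmu_seminorm[OF x, of m k \<mu> \<phi>]] by simp
    qed
    then show "\<exists>B. \<forall>x\<in>orthant. (1 + (norm x)\<^sup>2) ^ m * norm (fold T_op u (weighted \<mu> \<phi>) x) \<le> B"
      by blast
  next
    fix m and k :: "'a multi_index"
    assume ?R
    then obtain B where "\<forall>x\<in>orthant. (1 + (norm x)\<^sup>2) ^ m * norm (fold T_op (mi_word k) (weighted \<mu> \<phi>) x) \<le> B"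
      by blast
    then have "Hmu_seminorm \<mu> m k \<phi> \<le> ennreal B"
      by (intro Hmu_seminorm_le ennreal_leI) blast
    then show "Hmu_seminorm \<mu> m k \<phi> < \<infinity>"
      by (rule order_le_less_trans) simp
  qed
  then show ?thesis
    by (auto simp: Hmu_def)
qed

lemma Hmu_C_infinity: "\<phi> \<in> Hmu \<mu> \<Longrightarrow> C_infinity_on orthant \<phi>"
  by (simp add: Hmu_iff)

lemma C_infinity_on_weighted_Hmu: "\<phi> \<in> Hmu \<mu> \<Longrightarrow> C_infinity_on orthant (weighted \<mu> \<phi>)"
  by (intro C_infinity_on_weighted Hmu_C_infinity)

lemma T_regular_weighted:
  assumes "\<phi> \<in> Hmu \<mu>"
  shows "T_regular (weighted \<mu> \<phi>)"
  unfolding T_regular_def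
proof (intro conjI allI)
  show "C_infinity_on orthant (weighted \<mu> \<phi>)"
    by (rule C_infinity_on_weighted_Hmu[OF assms])
  fix u
  obtain B where "\<forall>x\<in>orthant. (1 + (norm x)\<^sup>2) ^ 0 * norm (fold T_op u (weighted \<mu> \<phi>) x) \<le> B"
    using assms unfolding Hmu_iff by blast
  then show "\<exists>B. \<forall>x\<in>orthant. norm x \<le> 1 \<longrightarrow> norm (fold T_op u (weighted \<mu> \<phi>) x) \<le> B"
    by auto
qed

lemma Hmu_add:
  assumes "\<phi> \<in> Hmu \<mu>" "\<psi> \<in> Hmu \<mu>"
  shows "(\<lambda>x. \<phi> x + \<psi> x) \<in> Hmu \<mu>"
  unfolding Hmu_iff
proof (intro conjI allI)
  fix m u
  obtain B1 B2 where
    "\<forall>x\<in>orthant. (1 + (norm x)\<^sup>2) ^ m * norm (fold T_op u (weighted \<mu> \<phi>) x) \<le> B1"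
    "\<forall>x\<in>orthant. (1 + (norm x)\<^sup>2) ^ m * norm (fold T_op u (weighted \<mu> \<psi>) x) \<le> B2"
    using assms unfolding Hmu_iff by metis
  moreover have "(1 + (norm x)\<^sup>2) ^ m * norm (fold T_op u (weighted \<mu> (\<lambda>x. \<phi> x + \<psi> x)) x) \<le>
      (1 + (norm x)\<^sup>2) ^ m * norm (fold T_op u (weighted \<mu> \<phi>) x) +
      (1 + (norm x)\<^sup>2) ^ m * norm (fold T_op u (weighted \<mu> \<psi>) x)" if "x \<in> orthant" for x
    unfolding weighted_add distrib_left[symmetric]
      fold_T_op_add[OF assms[THEN C_infinity_on_weighted_Hmu] that]
    by (intro mult_left_mono norm_triangle_ineq) simp
  ultimately show "\<exists>B. \<forall>x\<in>orthant. (1 + (norm x)\<^sup>2) ^ m *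
      norm (fold T_op u (weighted \<mu> (\<lambda>x. \<phi> x + \<psi> x)) x) \<le> B"
    by (intro exI[of _ "B1 + B2"]) (meson add_mono order_trans)
qed (use assms in \<open>auto simp: Hmu_iff intro: C_infinity_on_add open_orthant\<close>)

lemma Hmu_cmult:
  assumes "\<phi> \<in> Hmu \<mu>"
  shows "(\<lambda>x. c * \<phi> x) \<in> Hmu \<mu>"
  unfolding Hmu_iff
proof (intro conjI allI)
  fix m u
  obtain B where "\<forall>x\<in>orthant. (1 + (norm x)\<^sup>2) ^ m * norm (fold T_op u (weighted \<mu> \<phi>) x) \<le> B"
    using assms unfolding Hmu_iff by metis
  moreover have "(1 + (norm x)\<^sup>2) ^ m * norm (fold T_op u (weighted \<mu> (\<lambda>x. c * \<phi> x)) x) =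
      norm c * ((1 + (norm x)\<^sup>2) ^ m * norm (fold T_op u (weighted \<mu> \<phi>) x))" if "x \<in> orthant" for x
    using fold_T_op_cmult[OF C_infinity_on_weighted_Hmu[OF assms] that, of u c]
    by (simp add: weighted_cmult norm_mult del: mult_cancel_left)
  ultimately show "\<exists>B. \<forall>x\<in>orthant. (1 + (norm x)\<^sup>2) ^ m *
      norm (fold T_op u (weighted \<mu> (\<lambda>x. c * \<phi> x)) x) \<le> B"
    by (intro exI[of _ "norm c * B"]) (metis mult_left_mono norm_ge_zero)
qed (use assms in \<open>auto simp: Hmu_iff intro!: C_infinity_on_mult C_infinity_on_const open_orthant\<close>)

lemma Hmu_diff:
  assumes "\<phi> \<in> Hmu \<mu>" "\<psi> \<in> Hmu \<mu>"
  shows "(\<lambda>x. \<phi> x - \<psi> x) \<in> Hmu \<mu>"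
  using Hmu_add[OF assms(1) Hmu_cmult[OF assms(2), of "-1"]] by simp

lemma Hmu_zero: "(\<lambda>x. 0) \<in> Hmu \<mu>"
proof -
  have "Hmu_seminorm \<mu> m k (\<lambda>x. 0) < \<infinity>" for m k
    by (simp add: Hmu_seminorm_zero)
  then show ?thesis
    unfolding Hmu_def by (simp add: C_infinity_on_const)
qed

section \<open>Continuity of functionals in terms of seminorms\<close>

lemma Hmu_seminorm_triangle:
  fixes \<mu> :: "(real, 'n::{finite,linorder}) vec"
  assumes "\<phi> \<in> Hmu \<mu>" "\<psi> \<in> Hmu \<mu>"
  shows "Hmu_seminorm \<mu> m k (\<lambda>x. \<phi> x + \<psi> x) \<le> Hmu_seminorm \<mu> m k \<phi> + Hmu_seminorm \<mu> m k \<psi>"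
proof (rule Hmu_seminorm_le)
  fix x :: "(real, 'n) vec" assume x: "x \<in> orthant"
  let ?c = "(1 + (norm x)\<^sup>2) ^ m"
  have "?c * norm (fold T_op (mi_word k) (weighted \<mu> (\<lambda>x. \<phi> x + \<psi> x)) x) \<le>
      ?c * norm (fold T_op (mi_word k) (weighted \<mu> \<phi>) x) +
      ?c * norm (fold T_op (mi_word k) (weighted \<mu> \<psi>) x)"
    unfolding weighted_add distrib_left[symmetric]
      fold_T_op_add[OF assms[THEN C_infinity_on_weighted_Hmu] x]
    by (intro mult_left_mono norm_triangle_ineq) simp
  then have "ennreal (?c * norm (fold T_op (mi_word k) (weighted \<mu> (\<lambda>x. \<phi> x + \<psi> x)) x)) \<le>
      ennreal (?c * norm (fold T_op (mi_word k) (weighted \<mu> \<phi>) x)) +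
      ennreal (?c * norm (fold T_op (mi_word k) (weighted \<mu> \<psi>) x))"
    by (subst ennreal_plus[symmetric]) (auto simp del: ennreal_plus intro: ennreal_leI)
  also have "\<dots> \<le> Hmu_seminorm \<mu> m k \<phi> + Hmu_seminorm \<mu> m k \<psi>"
    by (intro add_mono le_Hmu_seminorm x)
  finally show "ennreal (?c * norm (fold T_op (mi_word k) (weighted \<mu> (\<lambda>x. \<phi> x + \<psi> x)) x)) \<le>
      Hmu_seminorm \<mu> m k \<phi> + Hmu_seminorm \<mu> m k \<psi>" .
qed

text \<open>The generating sets are balls of a single seminorm with arbitrary centres. The triangle
  inequality recentres such a ball at \<phi>, and finite intersections are handled by joining the
  sets of seminorms and taking the smaller radius.\<close>

lemma Hmu_open_contains_seminorm_ball:
  fixes \<mu> :: "(real, 'n::{finite,linorder}) vec"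
  assumes "openin (Hmu_topology \<mu>) U" "\<phi> \<in> U"
  shows "\<exists>F r. finite F \<and> 0 < r \<and>
    {\<psi> \<in> Hmu \<mu>. \<forall>(m, k)\<in>F. Hmu_seminorm \<mu> m k (\<lambda>x. \<psi> x - \<phi> x) < ennreal r} \<subseteq> U"
proof -
  let ?N = "\<lambda>F r. {\<psi> \<in> Hmu \<mu>. \<forall>(m, k)\<in>F. Hmu_seminorm \<mu> m k (\<lambda>x. \<psi> x - \<phi> x) < ennreal r}"
  have "generate_topology_on {{\<psi> \<in> Hmu \<mu>. Hmu_seminorm \<mu> m k (\<lambda>x. \<psi> x - \<phi> x) < ennreal r} | m k \<phi> r.
        \<phi> \<in> Hmu \<mu> \<and> 0 < r} U"
    using assms(1) unfolding Hmu_topology_def by (rule openin_topology_generated_by)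
  then show ?thesis
    using assms(2)
  proof (induction rule: generate_topology_on.induct)
    case Empty
    then show ?case by simp
  next
    case (Int a b)
    obtain F1 r1 where 1: "finite F1" "0 < r1" "?N F1 r1 \<subseteq> a" using Int by blast
    obtain F2 r2 where 2: "finite F2" "0 < r2" "?N F2 r2 \<subseteq> b" using Int by blast
    have "ennreal (min r1 r2) \<le> ennreal r1" "ennreal (min r1 r2) \<le> ennreal r2"
      by (auto intro: ennreal_leI)
    then have "?N (F1 \<union> F2) (min r1 r2) \<subseteq> ?N F1 r1" "?N (F1 \<union> F2) (min r1 r2) \<subseteq> ?N F2 r2"
      by (auto intro: order_less_le_trans)
    then show ?case
      using 1 2 by (intro exI[of _ "F1 \<union> F2"] exI[of _ "min r1 r2"]) auto
  next
    case (UN K)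
    then obtain k where "k \<in> K" "\<phi> \<in> k" by blast
    then show ?case using UN.IH[of k] by blast
  next
    case (Basis s)
    then obtain m k \<phi>0 \<rho> where s: "s = {\<psi> \<in> Hmu \<mu>. Hmu_seminorm \<mu> m k (\<lambda>x. \<psi> x - \<phi>0 x) < ennreal \<rho>}"
      and "\<phi>0 \<in> Hmu \<mu>" "0 < \<rho>" by blast
    \<comment> \<open>The seminorm distance from \<phi> to the old centre; the ball of radius \<rho>
      - a around \<phi> fits inside.\<close>
    define a where "a = enn2real (Hmu_seminorm \<mu> m k (\<lambda>x. \<phi> x - \<phi>0 x))"
    have \<phi>: "\<phi> \<in> Hmu \<mu>" and lt: "Hmu_seminorm \<mu> m k (\<lambda>x. \<phi> x - \<phi>0 x) < ennreal \<rho>"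
      using Basis s by auto
    have a: "Hmu_seminorm \<mu> m k (\<lambda>x. \<phi> x - \<phi>0 x) = ennreal a"
      using lt unfolding a_def by (metis ennreal_enn2real ennreal_less_top order_less_trans top.not_eq_extremum)
    have "a \<ge> 0" "a < \<rho>"
      using lt unfolding a by (auto simp: a_def ennreal_less_iff)
    have "\<psi> \<in> s" if \<psi>: "\<psi> \<in> Hmu \<mu>" and less: "Hmu_seminorm \<mu> m k (\<lambda>x. \<psi> x - \<phi> x) < ennreal (\<rho> - a)" for \<psi>
    proof -
      have "Hmu_seminorm \<mu> m k (\<lambda>x. \<psi> x - \<phi>0 x) \<le>
          Hmu_seminorm \<mu> m k (\<lambda>x. \<psi> x - \<phi> x) + Hmu_seminorm \<mu> m k (\<lambda>x. \<phi> x - \<phi>0 x)"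
        using Hmu_seminorm_triangle[OF Hmu_diff[OF \<psi> \<phi>] Hmu_diff[OF \<phi> \<open>\<phi>0 \<in> Hmu \<mu>\<close>], of m k] by simp
      also have "\<dots> < ennreal (\<rho> - a) + ennreal a"
        unfolding a using less by (subst add.commute, subst (2) add.commute) (simp add: ennreal_add_left_cancel_less)
      also have "\<dots> = ennreal \<rho>"
        using \<open>a \<ge> 0\<close> \<open>a < \<rho>\<close> by (subst ennreal_plus[symmetric]) auto
      finally show ?thesis
        using \<psi> by (simp add: s)
    qed
    then show ?case
      using \<open>a < \<rho>\<close> by (intro exI[of _ "{(m, k)}"] exI[of _ "\<rho> - a"]) auto
  qed
qed

lemma Hmu_dual_zero:
  assumes "T \<in> Hmu_dual \<mu>"
  shows "T (\<lambda>x. 0) = 0"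
proof -
  have "\<forall>c. \<forall>\<phi>\<in>Hmu \<mu>. T (\<lambda>x. c * \<phi> x) = c * T \<phi>"
    using assms by (simp add: Hmu_dual_def)
  from this[rule_format, OF Hmu_zero, of 0] show ?thesis by simp
qed

text \<open>The preimage of the unit ball is an open set containing the zero function, hence
  contains a ball given by finitely many seminorms.\<close>

lemma Hmu_dual_seminorm_bound:
  fixes \<mu> :: "(real, 'n::{finite,linorder}) vec"
  assumes "T \<in> Hmu_dual \<mu>"
  obtains F r where "finite F" "0 < r"
    "\<And>\<psi>. \<psi> \<in> Hmu \<mu> \<Longrightarrow> (\<And>m k. (m, k) \<in> F \<Longrightarrow> Hmu_seminorm \<mu> m k \<psi> < ennreal r) \<Longrightarrow> norm (T \<psi>) < 1"
proof -
  have "continuous_map (Hmu_topology \<mu>) euclidean T"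
    using assms by (simp add: Hmu_dual_def)
  then have "openin (Hmu_topology \<mu>) {\<psi> \<in> topspace (Hmu_topology \<mu>). T \<psi> \<in> ball 0 1}"
    by (rule openin_continuous_map_preimage) simp
  moreover have "(\<lambda>x. 0) \<in> {\<psi> \<in> topspace (Hmu_topology \<mu>). T \<psi> \<in> ball 0 1}"
    using Hmu_zero Hmu_dual_zero[OF assms] by (simp add: topspace_Hmu_topology)
  ultimately obtain F r where "finite F" "0 < r" and sub:
    "{\<psi> \<in> Hmu \<mu>. \<forall>(m, k)\<in>F. Hmu_seminorm \<mu> m k (\<lambda>x. \<psi> x - 0) < ennreal r} \<subseteq>
      {\<psi> \<in> topspace (Hmu_topology \<mu>). T \<psi> \<in> ball 0 1}"
    using Hmu_open_contains_seminorm_ball[of \<mu> _ "\<lambda>x. 0"] by blast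
  show ?thesis
    by (rule that[OF \<open>finite F\<close> \<open>0 < r\<close>]) (use sub in auto)
qed

section \<open>Cutting off near the origin\<close>

lemma Hmu_cutoff:
  fixes \<mu> :: "(real, 'n::{finite,linorder}) vec"
  assumes \<phi>: "\<phi> \<in> Hmu \<mu>" and D: "cutoff_derivs D" and q: "0 < q" "q \<le> 1/2"
  shows "(\<lambda>x. \<phi> x * radial (D 0) q x) \<in> Hmu \<mu>"
  unfolding Hmu_iff
proof (intro conjI allI)
  let ?w = "weighted \<mu> \<phi>"
  fix m and u :: "'n list"
  obtain A where A: "A \<ge> 0" "\<And>j t. j \<le> length u \<Longrightarrow> t \<ge> 0 \<Longrightarrow> \<bar>D j t\<bar> \<le> A"
    using cutoff_derivs_bounded[OF D, of "length u"] by metis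
  obtain B where B: "B \<ge> 0" "\<And>v x. length v \<le> length u \<Longrightarrow> x \<in> orthant \<Longrightarrow> norm x \<le> 1 \<Longrightarrow>
      norm (fold T_op v ?w x) \<le> B"
    using T_regularD[OF T_regular_weighted[OF \<phi>], of "length u"] by metis
  have w: "C_infinity_on orthant ?w"
    by (rule C_infinity_on_weighted_Hmu[OF \<phi>])
  let ?K = "2 ^ m * (A * B * 3 ^ length u / q ^ length u)"
  have "(1 + (norm x)\<^sup>2) ^ m * norm (fold T_op u (weighted \<mu> (\<lambda>x. \<phi> x * radial (D 0) q x)) x) \<le> ?K"
    if x: "x \<in> orthant" for x
  proof (cases "(norm x)\<^sup>2 > 2 * q")
    case True
    then show ?thesis
      using A B q fold_T_op_mult_radial_eq_0[OF w D x q(1), of u 0] by (simp add: weighted_mult_right)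
  next
    case False
    \<comment> \<open>The condition q \<le> 1/2 places the support of the cutoff in the unit ball,
      where the bounds on words hold and the polynomial weight is at most 2^m.\<close>
    then have x1: "(norm x)\<^sup>2 \<le> 1"
      using q by linarith
    then have nx: "norm x \<le> 1"
      by (simp add: abs_square_le_1)
    have "norm (fold T_op u (\<lambda>x. ?w x * radial (D 0) q x) x) \<le> A * B * 3 ^ length u / q ^ length u"
    proof (rule fold_T_op_mult_radial_bound[where K = "length u", OF w D x q(1) A(1)])
      show "norm (fold T_op v ?w x) \<le> B / q ^ length v" if "length v \<le> length u" for v
      proof -
        have "q ^ length v \<le> 1"
          using q by (intro power_le_one) auto
        then have "B * q ^ length v \<le> B"
          using B(1) by (simp add: mult_left_le)
        then have "B \<le> B / q ^ length v"
          using q by (simp add: field_simps)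
        with B(2)[OF that x nx] show ?thesis by simp
      qed
    qed (use A(2) q in auto)
    moreover have "(1 + (norm x)\<^sup>2) ^ m \<le> 2 ^ m"
      using x1 by (intro power_mono) auto
    ultimately show ?thesis
      unfolding weighted_mult_right by (intro mult_mono) auto
  qed
  then show "\<exists>B. \<forall>x\<in>orthant. (1 + (norm x)\<^sup>2) ^ m *
      norm (fold T_op u (weighted \<mu> (\<lambda>x. \<phi> x * radial (D 0) q x)) x) \<le> B"
    by blast
qed (use \<phi> in \<open>auto simp: Hmu_iff intro!: C_infinity_on_mult C_infinity_on_radial D open_orthant\<close>)

lemma orthant_supp_minus_cutoff:
  assumes D: "cutoff_derivs D" and q: "0 < q"
  shows "orthant_supp (\<lambda>x. \<phi> x - \<phi> x * radial (D 0) q x) \<subseteq> {x \<in> orthant. sqrt q \<le> norm x}"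
proof -
  have "\<phi> x - \<phi> x * radial (D 0) q x = 0" if "norm x < sqrt q" for x
  proof -
    have "(norm x)\<^sup>2 \<le> q"
      using that q by (smt (verit) norm_ge_zero power_mono real_sqrt_pow2)
    then have "D 0 ((norm x)\<^sup>2 / q) = 1"
      using q by (intro cutoff_derivsD(2)[OF D]) simp
    then show ?thesis by (simp add: radial_def)
  qed
  then have "{x \<in> orthant. \<phi> x - \<phi> x * radial (D 0) q x \<noteq> 0} \<subseteq> {x. sqrt q \<le> norm x}"
    by (auto simp: not_less[symmetric])
  moreover have "closed {x :: real ^ 'a. sqrt q \<le> norm x}"
    by (intro closed_Collect_le continuous_intros)
  ultimately have "closure {x \<in> orthant. \<phi> x - \<phi> x * radial (D 0) q x \<noteq> 0} \<subseteq> {x. sqrt q \<le> norm x}"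
    by (rule closure_minimal)
  then show ?thesis
    unfolding orthant_supp_def by blast
qed

text \<open>If all limits of order at most \<open>N\<close> vanish, a word of length \<open>l \<le> N\<close> applied to the
  function is \<open>O(q\<^bsup>N+1-l\<^esup>)\<close> on the support of the cutoff, while the cutoff costs at most
  \<open>q\<^bsup>-l\<^esup>\<close>.\<close>

lemma Hmu_cutoff_seminorm_small:
  fixes \<mu> :: "(real, 'n::{finite,linorder}) vec"
  assumes \<phi>: "\<phi> \<in> Hmu \<mu>" and D: "cutoff_derivs D"
    and lim: "\<And>u. length u \<le> N \<Longrightarrow> origin_lim (fold T_op u (weighted \<mu> \<phi>)) = 0"
    and F: "finite F" "\<And>m k. (m, k) \<in> F \<Longrightarrow> mi_abs k \<le> N" and "0 < r"
  shows "\<exists>q. 0 < q \<and> q \<le> 1/2 \<and>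
    (\<forall>(m, k)\<in>F. Hmu_seminorm \<mu> m k (\<lambda>x. \<phi> x * radial (D 0) q x) < ennreal r)"
proof -
  let ?w = "weighted \<mu> \<phi>" and ?n = "real CARD('n)"
  have reg: "T_regular ?w"
    by (rule T_regular_weighted[OF \<phi>])
  have w: "C_infinity_on orthant ?w"
    by (rule T_regular_C_infinity[OF reg])
  obtain A where A: "A \<ge> 0" "\<And>j t. j \<le> N \<Longrightarrow> t \<ge> 0 \<Longrightarrow> \<bar>D j t\<bar> \<le> A"
    using cutoff_derivs_bounded[OF D, of N] by metis
  obtain B where B: "B \<ge> 0" "\<And>v x. length v \<le> Suc N \<Longrightarrow> x \<in> orthant \<Longrightarrow> norm x \<le> 1 \<Longrightarrow>
      norm (fold T_op v ?w x) \<le> B"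
    using T_regularD[OF reg, of "Suc N"] by metis
  obtain M where M: "\<And>m k. (m, k) \<in> F \<Longrightarrow> m \<le> M"
  proof -
    have "finite (fst ` F)" using F by simp
    then obtain M where "\<forall>m\<in>fst ` F. m \<le> M"
      using finite_nat_set_iff_bounded_le by blast
    then show ?thesis
      by (intro that[of M]) force
  qed
  \<comment> \<open>Absorbs the factors n^j and 2^j for all j \<le> N + 1. The powers of 2 stem from
    ||x||^2 \<le> 2q on the support of the cutoff.\<close>
  define C where "C = B * ?n ^ Suc N * 2 ^ Suc N"
  have "C \<ge> 0" using B by (simp add: C_def)
  define K where "K = 2 ^ M * (A * C * 3 ^ N)"
  have "K \<ge> 0" using A \<open>C \<ge> 0\<close> by (simp add: K_def)
  \<comment> \<open>Chosen so that K q < r; the summand 1 keeps the denominator positive when K =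
    0.\<close>
  define q where "q = min (1/2) (r / (2 * (K + 1)))"
  have q: "0 < q" "q \<le> 1/2"
    using \<open>0 < r\<close> \<open>K \<ge> 0\<close> by (simp_all only: q_def min.cobounded1) simp
  then have "q \<le> 1" by simp
  have "K * q \<le> K * (r / (2 * (K + 1)))"
    using \<open>K \<ge> 0\<close> by (intro mult_left_mono) (auto simp: q_def)
  also have "\<dots> < r"
    using \<open>0 < r\<close> \<open>K \<ge> 0\<close> by (simp add: field_simps add_nonneg_pos)
  finally have "K * q < r" .
  have "Hmu_seminorm \<mu> m k (\<lambda>x. \<phi> x * radial (D 0) q x) < ennreal r" if mk: "(m, k) \<in> F" for m k
  proof -
    define u where "u = mi_word k"
    have u: "length u \<le> N"
      using F(2)[OF mk] by (simp add: u_def length_mi_word)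
    have "(1 + (norm x)\<^sup>2) ^ m * norm (fold T_op u (\<lambda>x. ?w x * radial (D 0) q x) x) \<le> K * q"
      if x: "x \<in> orthant" for x
    proof (cases "(norm x)\<^sup>2 > 2 * q")
      case True
      then show ?thesis
        using \<open>K \<ge> 0\<close> q fold_T_op_mult_radial_eq_0[OF w D x q(1), of u 0] by simp
    next
      case False
      then have x1: "(norm x)\<^sup>2 \<le> 2 * q" "(norm x)\<^sup>2 \<le> 1"
        using q by auto
      then have nx: "norm x \<le> 1"
        by (simp add: abs_square_le_1)
      \<comment> \<open>The general product bound is used with the constant C q^(N+1): the decay
        estimate started at order N + 1 has exactly the required form.\<close>
      have "norm (fold T_op u (\<lambda>x. ?w x * radial (D 0) q x) x) \<le>
          A * (C * q ^ Suc N) * 3 ^ length u / q ^ length u"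
      proof (rule fold_T_op_mult_radial_bound[where K = N, OF w D x q(1) A(1)])
        show "norm (fold T_op v ?w x) \<le> C * q ^ Suc N / q ^ length v" if "length v \<le> length u" for v
        proof -
          define j where "j = Suc N - length v"
          have j: "length v + j = Suc N" "j \<le> Suc N"
            using that u by (auto simp: j_def)
          have "norm (fold T_op v ?w x) \<le> B * ?n ^ j * norm x ^ (2 * j)"
            by (rule T_regular_decay[OF reg B(1) _ _ j(1) x nx]) (use B(2) lim in auto)
          also have "\<dots> = B * ?n ^ j * ((norm x)\<^sup>2) ^ j"
            by (simp add: power_mult)
          also have "\<dots> \<le> B * ?n ^ j * (2 * q) ^ j"
            using x1 B(1) by (intro mult_left_mono power_mono) auto
          also have "\<dots> = B * ?n ^ j * 2 ^ j * q ^ j"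
            by (simp add: power_mult_distrib)
          also have "\<dots> \<le> C * q ^ j"
            unfolding C_def using B(1) q j(2) one_le_power[of ?n]
            by (intro mult_right_mono mult_mono power_increasing mult_left_mono)
              (auto simp: Suc_le_eq intro!: mult_nonneg_nonneg)
          also have "\<dots> = C * q ^ Suc N / q ^ length v"
            using q unfolding j(1)[symmetric] by (simp add: power_add)
          finally show ?thesis .
        qed
      qed (use A(2) q u in auto)
      also have "\<dots> = A * C * 3 ^ length u * (q ^ (Suc N - length u))"
        using q u by (simp add: power_diff)
      \<comment> \<open>As \<open>u\<close> has at most N letters, at least one power of q
        survives.\<close>
      also have "\<dots> \<le> A * C * 3 ^ N * q ^ 1"
        using A(1) \<open>C \<ge> 0\<close> q u
        by (intro mult_mono mult_left_mono power_increasing power_decreasing mult_nonneg_nonneg) auto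
      finally have "norm (fold T_op u (\<lambda>x. ?w x * radial (D 0) q x) x) \<le> A * C * 3 ^ N * q"
        by simp
      moreover have "(1 + (norm x)\<^sup>2) ^ m \<le> 2 ^ M"
      proof -
        have "(1 + (norm x)\<^sup>2) ^ m \<le> 2 ^ m"
          using x1 by (intro power_mono) auto
        also have "\<dots> \<le> 2 ^ M"
          using M[OF mk] by (intro power_increasing) auto
        finally show ?thesis .
      qed
      ultimately have "(1 + (norm x)\<^sup>2) ^ m * norm (fold T_op u (\<lambda>x. ?w x * radial (D 0) q x) x) \<le>
          2 ^ M * (A * C * 3 ^ N * q)"
        by (intro mult_mono) auto
      then show ?thesis by (simp add: K_def)
    qed
    then have "Hmu_seminorm \<mu> m k (\<lambda>x. \<phi> x * radial (D 0) q x) \<le> ennreal (K * q)"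
      unfolding u_def by (intro Hmu_seminorm_le ennreal_leI) (simp add: weighted_mult_right)
    also have "\<dots> < ennreal r"
      using \<open>K * q < r\<close> \<open>0 < r\<close> by (simp add: ennreal_lessI)
    finally show ?thesis .
  qed
  then show ?thesis
    using q by (intro exI[of _ q]) auto
qed

text \<open>Induction on the number of functionals, with the space allowed to shrink: on the kernel
  of l_k the remaining functionals suffice, and a single vector e with l_k e nonzero determines the
  missing coefficient. The space is a set of functions since the functionals are linear only
  there.\<close>

lemma common_kernel_imp_combination:
  fixes T :: "('a \<Rightarrow> complex) \<Rightarrow> complex" and l :: "'k \<Rightarrow> ('a \<Rightarrow> complex) \<Rightarrow> complex"
  assumes "finite F"
    and "\<And>f g. f \<in> V \<Longrightarrow> g \<in> V \<Longrightarrow> (\<lambda>x. f x + g x) \<in> V" "\<And>a f. f \<in> V \<Longrightarrow> (\<lambda>x. a * f x) \<in> V"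
    and "\<And>f g. f \<in> V \<Longrightarrow> g \<in> V \<Longrightarrow> T (\<lambda>x. f x + g x) = T f + T g"
    and "\<And>a f. f \<in> V \<Longrightarrow> T (\<lambda>x. a * f x) = a * T f"
    and "\<And>k f g. f \<in> V \<Longrightarrow> g \<in> V \<Longrightarrow> l k (\<lambda>x. f x + g x) = l k f + l k g"
    and "\<And>k a f. f \<in> V \<Longrightarrow> l k (\<lambda>x. a * f x) = a * l k f"
    and "\<And>f. f \<in> V \<Longrightarrow> (\<And>k. k \<in> F \<Longrightarrow> l k f = 0) \<Longrightarrow> T f = 0"
  shows "\<exists>c. \<forall>f\<in>V. T f = (\<Sum>k\<in>F. c k * l k f)"
  using assms
proof (induction F arbitrary: V rule: finite_induct)
  case empty
  then show ?case by auto
next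
  case (insert k F)
  define V' where "V' = {f \<in> V. l k f = 0}"
  have "\<exists>c. \<forall>f\<in>V'. T f = (\<Sum>k\<in>F. c k * l k f)"
  proof (rule insert.IH)
    show "T f = 0" if "f \<in> V'" "\<And>k. k \<in> F \<Longrightarrow> l k f = 0" for f
      using that by (intro insert.prems(7)) (auto simp: V'_def)
  qed (auto simp: V'_def insert.prems)
  then obtain c where c: "\<And>f. f \<in> V' \<Longrightarrow> T f = (\<Sum>k\<in>F. c k * l k f)"
    by blast
  show ?case
  proof (cases "\<exists>e\<in>V. l k e \<noteq> 0")
    case False
    then have "T f = (\<Sum>j\<in>insert k F. c j * l j f)" if "f \<in> V" for f
      using c[of f] that insert.hyps by (auto simp: V'_def)
    then show ?thesis by blast
  next
    case True
    then obtain e where e: "e \<in> V" "l k e \<noteq> 0" by blast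
    \<comment> \<open>The coefficient forced by requiring the combination to agree with T at
      \<open>e\<close>.\<close>
    define d where "d = (T e - (\<Sum>j\<in>F. c j * l j e)) / l k e"
    have "T f = (\<Sum>j\<in>insert k F. (c(k := d)) j * l j f)" if f: "f \<in> V" for f
    proof -
      define a where "a = - (l k f / l k e)"
      \<comment> \<open>The projection of \<open>f\<close> along \<open>e\<close> into the kernel of
        \<open>l k\<close>.\<close>
      define g where "g = (\<lambda>x. f x + a * e x)"
      have ae: "(\<lambda>x. a * e x) \<in> V"
        using e insert.prems(2) by blast
      have lg: "l j g = l j f + a * l j e" for j
        using insert.prems(5)[OF f ae] insert.prems(6)[OF e(1)] by (simp add: g_def)
      have "T g = T f + a * T e"
        using insert.prems(3)[OF f ae] insert.prems(4)[OF e(1)] by (simp add: g_def)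
      moreover have "g \<in> V'"
        using insert.prems(1)[OF f ae] e lg[of k] by (simp add: V'_def g_def a_def)
      then have "T g = (\<Sum>j\<in>F. c j * l j f) + a * (\<Sum>j\<in>F. c j * l j e)"
        by (simp add: c lg algebra_simps sum.distrib sum_distrib_left)
      ultimately have "T f = (\<Sum>j\<in>F. c j * l j f) + l k f * d"
        using e by (simp add: a_def d_def field_simps)
      moreover have "(\<Sum>j\<in>F. (c(k := d)) j * l j f) = (\<Sum>j\<in>F. c j * l j f)"
        using insert.hyps by (intro sum.cong) auto
      ultimately show ?thesis
        using insert.hyps by simp
    qed
    then show ?thesis by blast
  qed
qed

section \<open>The functionals S^k \<delta>_\<mu> as limits at the origin\<close>

lemma C_mu_neq_0:
  assumes "\<And>i. - 1/2 \<le> \<mu> $ i"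
  shows "C_mu \<mu> \<noteq> 0"
proof -
  have "Gamma (\<mu> $ i + 1) > 0" for i
    using assms[of i] by (intro Gamma_real_pos) simp
  then show ?thesis
    by (simp add: C_mu_def) (metis less_irrefl)
qed

text \<open>The bound \<mu>_i \<ge> -1/2 makes all first-order coefficients 2\<mu>_i + 2 positive
  and keeps the Gamma factors positive. The resulting constant depends on k alone and can be divided
  out.\<close>

lemma S_pow_dual_delta_mu:
  fixes \<mu> :: "(real, 'n::{finite,linorder}) vec"
  assumes mu: "\<And>i. - 1/2 \<le> \<mu> $ i"
  obtains d where "\<And>k. d k \<noteq> 0" "\<And>k \<phi>. \<phi> \<in> Hmu \<mu> \<Longrightarrow>
    S_pow_dual \<mu> k (delta_mu \<mu>) \<phi> = d k * origin_lim (fold T_op (mi_word k) (weighted \<mu> \<phi>))"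
proof -
  have "2 * \<mu> $ i + 2 > 0" for i
    using mu[of i] by simp
  then have "\<exists>\<kappa>>0. \<forall>h. T_regular h \<longrightarrow>
      origin_lim (foldr (\<lambda>i. bessel_op (2 * \<mu> $ i + 2) i) v h) = of_real \<kappa> * origin_lim (fold T_op v h)" for v
    using origin_lim_foldr_bessel_op[of "\<lambda>i. 2 * \<mu> $ i + 2" "[]" v] by simp
  then have "\<exists>\<kappa>. \<forall>v. \<kappa> v > 0 \<and> (\<forall>h. T_regular h \<longrightarrow>
      origin_lim (foldr (\<lambda>i. bessel_op (2 * \<mu> $ i + 2) i) v h) = of_real (\<kappa> v) * origin_lim (fold T_op v h))"
    by (intro choice allI)
  then obtain \<kappa> where \<kappa>: "\<And>v. \<kappa> v > 0" "\<And>v h. T_regular h \<Longrightarrow>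
      origin_lim (foldr (\<lambda>i. bessel_op (2 * \<mu> $ i + 2) i) v h) = of_real (\<kappa> v) * origin_lim (fold T_op v h)"
    by blast
  show ?thesis
  proof (rule that[of "\<lambda>k. of_real (C_mu \<mu> * \<kappa> (mi_word k))"])
    show "complex_of_real (C_mu \<mu> * \<kappa> (mi_word k)) \<noteq> 0" for k
      using C_mu_neq_0[OF mu] \<kappa>(1)[of "mi_word k"] by simp
    fix k and \<phi> assume \<phi>: "\<phi> \<in> Hmu \<mu>"
    have "origin_lim (weighted \<mu> (S_pow \<mu> k \<phi>)) =
        origin_lim (foldr (\<lambda>i. bessel_op (2 * \<mu> $ i + 2) i) (mi_word k) (weighted \<mu> \<phi>))"
      unfolding S_pow_eq_foldr by (intro origin_lim_cong weighted_foldr_S_op Hmu_C_infinity[OF \<phi>])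
    then show "S_pow_dual \<mu> k (delta_mu \<mu>) \<phi> = of_real (C_mu \<mu> * \<kappa> (mi_word k)) *
        origin_lim (fold T_op (mi_word k) (weighted \<mu> \<phi>))"
      by (simp add: S_pow_dual_def delta_mu_def \<kappa>(2)[OF T_regular_weighted[OF \<phi>]] flip: origin_lim_def)
  qed
qed

lemma origin_lim_add:
  assumes "T_regular f" "T_regular g"
  shows "origin_lim (\<lambda>x. f x + g x) = origin_lim f + origin_lim g"
  by (intro origin_lim_eqI tendsto_add tendsto_origin_lim assms)

lemma origin_lim_cmult: "T_regular f \<Longrightarrow> origin_lim (\<lambda>x. c * f x) = c * origin_lim f"
  by (intro origin_lim_eqI tendsto_mult_left tendsto_origin_lim)

theorem theorem4p1:
  fixes \<mu> :: "(real, 'n::{finite,linorder}) vec"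
    and T :: "((real, 'n) vec \<Rightarrow> complex) \<Rightarrow> complex"
  assumes mu: "\<And>i. - 1/2 \<le> \<mu> $ i"
    and T_dual: "T \<in> Hmu_dual \<mu>"
    and T_supp: "\<And>\<phi>. \<phi> \<in> Hmu \<mu> \<Longrightarrow>
      (\<exists>a::real. 0 < a \<and> orthant_supp \<phi> \<subseteq> {x \<in> orthant. a \<le> norm x}) \<Longrightarrow> T \<phi> = 0"
  shows "\<exists>(N::nat) (c :: 'n multi_index \<Rightarrow> complex). \<forall>\<phi>\<in>Hmu \<mu>.
    T \<phi> = (\<Sum>k\<in>{k. mi_abs k \<le> N}. c k * S_pow_dual \<mu> k (delta_mu \<mu>) \<phi>)"
proof -
  have T_add: "T (\<lambda>x. \<phi> x + \<psi> x) = T \<phi> + T \<psi>" if "\<phi> \<in> Hmu \<mu>" "\<psi> \<in> Hmu \<mu>" for \<phi> \<psi>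
    using T_dual that by (simp add: Hmu_dual_def)
  have T_cmult: "T (\<lambda>x. a * \<phi> x) = a * T \<phi>" if "\<phi> \<in> Hmu \<mu>" for a \<phi>
    using T_dual that by (simp add: Hmu_dual_def)
  obtain F r where F: "finite F" "0 < r" and bound:
    "\<And>\<psi>. \<psi> \<in> Hmu \<mu> \<Longrightarrow> (\<And>m k. (m, k) \<in> F \<Longrightarrow> Hmu_seminorm \<mu> m k \<psi> < ennreal r) \<Longrightarrow> norm (T \<psi>) < 1"
    using Hmu_dual_seminorm_bound[OF T_dual] by metis
  \<comment> \<open>The highest order among the finitely many seminorms that control T; it becomes
    the order of the final sum.\<close>
  obtain N where N: "\<And>m k. (m, k) \<in> F \<Longrightarrow> mi_abs k \<le> N"
  proof -
    have "finite ((\<lambda>(m, k). mi_abs k) ` F)" using F by simp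
    then obtain N where "\<forall>n\<in>(\<lambda>(m, k). mi_abs k) ` F. n \<le> N"
      using finite_nat_set_iff_bounded_le by blast
    then show ?thesis
      by (intro that[of N]) force
  qed
  obtain D where D: "cutoff_derivs D"
    using cutoff_derivs_exist by blast
  define l where "l k \<phi> = origin_lim (fold T_op (mi_word k) (weighted \<mu> \<phi>))" for k \<phi>
  have reg: "T_regular (fold T_op u (weighted \<mu> \<phi>))" if "\<phi> \<in> Hmu \<mu>" for u \<phi>
    by (intro T_regular_fold_T_op T_regular_weighted that)
  have Cw: "C_infinity_on orthant (weighted \<mu> \<phi>)" if "\<phi> \<in> Hmu \<mu>" for \<phi>
    by (rule C_infinity_on_weighted_Hmu[OF that])
  have l_add: "l k (\<lambda>x. \<phi> x + \<psi> x) = l k \<phi> + l k \<psi>" if "\<phi> \<in> Hmu \<mu>" "\<psi> \<in> Hmu \<mu>" for k \<phi> \<psi>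
    unfolding l_def weighted_add origin_lim_add[OF reg reg, OF that, symmetric]
    by (intro origin_lim_cong fold_T_op_add Cw that)
  have l_cmult: "l k (\<lambda>x. a * \<phi> x) = a * l k \<phi>" if "\<phi> \<in> Hmu \<mu>" for k a \<phi>
    unfolding l_def weighted_cmult origin_lim_cmult[OF reg, OF that, symmetric]
    by (intro origin_lim_cong fold_T_op_cmult Cw that)
  have small: "norm (T \<phi>) < 1" if \<phi>: "\<phi> \<in> Hmu \<mu>" and lim: "\<And>k. mi_abs k \<le> N \<Longrightarrow> l k \<phi> = 0" for \<phi>
  proof -
    \<comment> \<open>The hypothesis concerns multi-indices; counting the letters of
      \<open>u\<close> carries it over to words.\<close>
    have "origin_lim (fold T_op u (weighted \<mu> \<phi>)) = 0" if u: "length u \<le> N" for u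
    proof -
      let ?k = "count (mset u)"
      have "length (mi_word ?k) = length u"
        by (metis mset_mi_word_count size_mset)
      then have "l ?k \<phi> = 0"
        using u by (intro lim) (simp add: length_mi_word)
      moreover have "origin_lim (fold T_op u (weighted \<mu> \<phi>)) = l ?k \<phi>"
        unfolding l_def
        by (intro origin_lim_cong fold_T_op_perm Cw \<phi>) (simp add: mset_mi_word_count)
      ultimately show ?thesis by simp
    qed
    then have "\<exists>q. 0 < q \<and> q \<le> 1/2 \<and>
        (\<forall>(m, k)\<in>F. Hmu_seminorm \<mu> m k (\<lambda>x. \<phi> x * radial (D 0) q x) < ennreal r)"
      by (rule Hmu_cutoff_seminorm_small[where N = N, OF \<phi> D _ F(1) _ F(2)]) (auto intro: N)
    then obtain q where q: "0 < q" "q \<le> 1/2" and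
      less: "\<And>m k. (m, k) \<in> F \<Longrightarrow> Hmu_seminorm \<mu> m k (\<lambda>x. \<phi> x * radial (D 0) q x) < ennreal r"
      by blast
    let ?\<psi> = "\<lambda>x. \<phi> x * radial (D 0) q x"
    have \<psi>: "?\<psi> \<in> Hmu \<mu>"
      by (rule Hmu_cutoff[OF \<phi> D q])
    have "T (\<lambda>x. \<phi> x - ?\<psi> x) = 0"
      using orthant_supp_minus_cutoff[OF D q(1), of \<phi>] q(1)
      by (intro T_supp Hmu_diff \<phi> \<psi> exI[of _ "sqrt q"]) simp
    then have "T \<phi> = T ?\<psi>"
      using T_add[OF \<psi> Hmu_diff[OF \<phi> \<psi>]] by simp
    also have "norm \<dots> < 1"
      by (rule bound[OF \<psi> less])
    finally show ?thesis .
  qed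
  have "T \<phi> = 0" if \<phi>: "\<phi> \<in> Hmu \<mu>" and lim: "\<And>k. k \<in> {k. mi_abs k \<le> N} \<Longrightarrow> l k \<phi> = 0" for \<phi>
  proof (rule ccontr)
    assume nz: "T \<phi> \<noteq> 0"
    let ?a = "inverse (T \<phi>)"
    \<comment> \<open>The rescaled function still has vanishing limits, yet T takes the value 1 on
      it.\<close>
    have "norm (T (\<lambda>x. ?a * \<phi> x)) < 1"
      using lim by (intro small Hmu_cmult \<phi>) (simp add: l_cmult \<phi>)
    then show False
      using nz by (simp add: T_cmult \<phi>)
  qed
  then obtain c where c: "\<And>\<phi>. \<phi> \<in> Hmu \<mu> \<Longrightarrow> T \<phi> = (\<Sum>k\<in>{k. mi_abs k \<le> N}. c k * l k \<phi>)"
    using common_kernel_imp_combination[OF finite_mi_abs_le[of N], where V = "Hmu \<mu>" and T = T and l = l,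
        OF Hmu_add Hmu_cmult T_add T_cmult l_add l_cmult] by blast
  obtain d where d: "\<And>k. d k \<noteq> 0" "\<And>k \<phi>. \<phi> \<in> Hmu \<mu> \<Longrightarrow> S_pow_dual \<mu> k (delta_mu \<mu>) \<phi> = d k * l k \<phi>"
    using S_pow_dual_delta_mu[OF mu] unfolding l_def by metis
  have "\<forall>\<phi>\<in>Hmu \<mu>. T \<phi> = (\<Sum>k\<in>{k. mi_abs k \<le> N}. c k / d k * S_pow_dual \<mu> k (delta_mu \<mu>) \<phi>)"
    using c d by simp
  then show ?thesis
    by (intro exI[of _ N] exI[of _ "\<lambda>k. c k / d k"])
qed

end
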